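(* The order problem for bounded automorphisms is decidable: there is an algorithm which, given a bounded automorphism $a$ of the $d$-ary rooted tree $T$ (given by a finite automaton), determines the order $|a|\in\{1,2,3,\ldots\}\cup\{\infty\}$ of $a$ in $\mathrm{Aut}(T)$.
   Context: Let $X=\{1,2,\ldots,d\}$ and let $T$ be the regular rooted $d$-ary tree whose vertices are the words in the free monoid $X^*$ (the root is the empty word, and $v$ is adjacent to $vx$ for $v\in X^*$, $x\in X$). $\mathrm{Aut}(T)$ is the group of automorphisms of $T$ as a rooted tree, acting on the right ($v^{gh}=(v^g)^h$). For $g\in\mathrm{Aut}(T)$ and $v\in X^*$, the state $g|_v\in\mathrm{Aut}(T)$ is the unique automorphism with $(vw)^g=v^g\,w^{g|_v}$ for all $w\in X^*$. An automorphism $g$ is finite-state if $Q(g)=\{g|_v: v\in X^*\}$ is finite; then $g$ is described by the finite automaton with state set $Q(g)$ and edges $g|_v\xrightarrow{x|y}g|_{vx}$, where $y=x^{g|_v}$, together with the initial state $g$. A finite-state automorphism $g$ is bounded if the sequence $\theta_k(g)=|\{v\in X^k : g|_v \text{ acts non-trivially on } X\}|$, $k\ge 0$, is bounded. *)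

theory Defs
  imports
    "HOL-Algebra.Bij"
    "HOL-Algebra.Multiplicative_Group"
    "HOL-Library.Nat_Bijection"
begin

section \<open>The rooted tree and its automorphism group\<close>

definition words :: "nat \<Rightarrow> nat list set" where
  "words d = lists {1..d}"

definition tree_adj :: "nat list \<Rightarrow> nat list \<Rightarrow> bool" where
  "tree_adj v w \<longleftrightarrow> (\<exists>x. w = v @ [x] \<or> v = w @ [x])"

text \<open>
  As for \<^const>\<open>Bij\<close>, automorphisms are extensional functions on the vertex set, so that equality of
  functions is equality of automorphisms.
\<close>

definition tree_auts :: "nat \<Rightarrow> (nat list \<Rightarrow> nat list) set" where
  "tree_auts d = {g \<in> Bij (words d). g [] = [] \<and>
     (\<forall>v\<in>words d. \<forall>w\<in>words d. tree_adj (g v) (g w) \<longleftrightarrow> tree_adj v w)}"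

text \<open>
  The action is on the right: \<open>g v\<close> stands for $v^g$, and the product of \<open>g\<close> and \<open>h\<close> is ``first \<open>g\<close>,
  then \<open>h\<close>''. For the order of an element, \<^const>\<open>group.ord\<close> uses the value \<open>0\<close> to mean infinite order.
\<close>

definition Aut_T :: "nat \<Rightarrow> (nat list \<Rightarrow> nat list) monoid" where
  "Aut_T d = \<lparr>carrier = tree_auts d,
     mult = (\<lambda>g\<in>tree_auts d. \<lambda>h\<in>tree_auts d. compose (words d) h g),
     one = (\<lambda>v\<in>words d. v)\<rparr>"

definition state_at :: "nat \<Rightarrow> (nat list \<Rightarrow> nat list) \<Rightarrow> nat list \<Rightarrow> nat list \<Rightarrow> nat list" where
  "state_at d g v = (THE h. h \<in> tree_auts d \<and> (\<forall>w\<in>words d. g (v @ w) = g v @ h w))"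

definition states :: "nat \<Rightarrow> (nat list \<Rightarrow> nat list) \<Rightarrow> (nat list \<Rightarrow> nat list) set" where
  "states d g = state_at d g ` words d"

definition finite_state :: "nat \<Rightarrow> (nat list \<Rightarrow> nat list) \<Rightarrow> bool" where
  "finite_state d g \<longleftrightarrow> g \<in> tree_auts d \<and> finite (states d g)"

definition theta :: "nat \<Rightarrow> (nat list \<Rightarrow> nat list) \<Rightarrow> nat \<Rightarrow> nat" where
  "theta d g k = card {v \<in> words d. length v = k \<and> (\<exists>x\<in>{1..d}. state_at d g v [x] \<noteq> [x])}"

definition bounded_aut :: "nat \<Rightarrow> (nat list \<Rightarrow> nat list) \<Rightarrow> bool" where
  "bounded_aut d g \<longleftrightarrow> finite_state d g \<and> (\<exists>C. \<forall>k. theta d g k \<le> C)"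


section \<open>Finite automata as input data\<close>

text \<open>
  An automaton with states \<open>0, \<dots>, n - 1\<close> is a pair of the initial state and a transition table with \<open>n\<close>
  rows of length \<open>d\<close>. An edge from \<open>i\<close> to \<open>j\<close> with label \<open>x|y\<close> is recorded as the entry \<open>(y, j)\<close> of
  row \<open>i\<close> in position \<open>x - 1\<close>, since letters are counted from \<open>1\<close> and list positions from \<open>0\<close>.
\<close>

type_synonym automaton = "nat \<times> (nat \<times> nat) list list"

text \<open>
  The map \<open>q\<close> is a numbering of the states of \<open>g\<close>; every numbering is admitted.
\<close>

definition automaton_of :: "nat \<Rightarrow> (nat list \<Rightarrow> nat list) \<Rightarrow> automaton \<Rightarrow> bool" where
  "automaton_of d g M \<longleftrightarrow> (case M of (i0, tab) \<Rightarrow>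
     (\<exists>q. bij_betw q {..<length tab} (states d g) \<and> i0 < length tab \<and> q i0 = g \<and>
       (\<forall>i<length tab. length (tab ! i) = d \<and>
         (\<forall>x\<in>{1..d}. case tab ! i ! (x - 1) of (y, j) \<Rightarrow>
            [y] = q i [x] \<and> j < length tab \<and> q j = state_at d (q i) [x]))))"

definition automaton_code :: "automaton \<Rightarrow> nat" where
  "automaton_code M = (case M of (i0, tab) \<Rightarrow>
     prod_encode (i0, list_encode (map (\<lambda>row. list_encode (map prod_encode row)) tab)))"


section \<open>Partial recursive functions\<close>

datatype recf =
    Zero
  | Succ
  | Proj nat
  | Comp recf "recf list"
  | PrimRec recf recf
  | Mu recf

text \<open>
  \<open>rec_eval f xs y\<close> means that \<open>f\<close> halts on the argument list \<open>xs\<close> with value \<open>y\<close>. The recursion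
  variable of \<^const>\<open>PrimRec\<close> and the search variable of \<^const>\<open>Mu\<close> are the first argument.
\<close>

inductive rec_eval :: "recf \<Rightarrow> nat list \<Rightarrow> nat \<Rightarrow> bool" where
  zero: "rec_eval Zero xs 0"
| succ: "rec_eval Succ [x] (Suc x)"
| proj: "i < length xs \<Longrightarrow> rec_eval (Proj i) xs (xs ! i)"
| comp: "length ys = length gs \<Longrightarrow> \<forall>i<length gs. rec_eval (gs ! i) xs (ys ! i) \<Longrightarrow>
    rec_eval f ys z \<Longrightarrow> rec_eval (Comp f gs) xs z"
| primrec_0: "rec_eval f xs y \<Longrightarrow> rec_eval (PrimRec f g) (0 # xs) y"
| primrec_Suc: "rec_eval (PrimRec f g) (n # xs) y \<Longrightarrow> rec_eval g (n # y # xs) z \<Longrightarrow>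
    rec_eval (PrimRec f g) (Suc n # xs) z"
| mu: "rec_eval f (n # xs) 0 \<Longrightarrow> \<forall>m<n. \<exists>y. rec_eval f (m # xs) (Suc y) \<Longrightarrow>
    rec_eval (Mu f) xs n"

lemma rec_eval_deterministic:
  "rec_eval f xs y \<Longrightarrow> rec_eval f xs z \<Longrightarrow> y = z"
proof (induction arbitrary: z rule: rec_eval.induct)
  case (zero xs)
  then show ?case by (cases rule: rec_eval.cases) auto
next
  case (succ x)
  then show ?case by (cases rule: rec_eval.cases) auto
next
  case (proj i xs)
  from proj.prems show ?case by (cases rule: rec_eval.cases) auto
next
  case (comp ys gs xs f w)
  from comp.prems obtain ys' where ys': "length ys' = length gs"
      "\<forall>i<length gs. rec_eval (gs ! i) xs (ys' ! i)" "rec_eval f ys' z"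
    by (cases rule: rec_eval.cases) auto
  have "ys = ys'"
    using comp.hyps(1) comp.IH(1) ys' by (intro nth_equalityI) auto
  then show ?case using comp.IH(2) ys' by blast
next
  case (primrec_0 f xs y g)
  from primrec_0.prems show ?case
    by (cases rule: rec_eval.cases) (auto intro: primrec_0.IH)
next
  case (primrec_Suc f g n xs y w)
  from primrec_Suc.prems obtain y' where
    "rec_eval (PrimRec f g) (n # xs) y'" "rec_eval g (n # y' # xs) z"
    by (cases rule: rec_eval.cases) auto
  then show ?case using primrec_Suc.IH by blast
next
  case (mu f n xs)
  from mu.prems have z: "rec_eval f (z # xs) 0" "\<forall>m<z. \<exists>y. rec_eval f (m # xs) (Suc y)"
    by (cases rule: rec_eval.cases; auto)+
  show ?case
  proof (rule linorder_cases[of n z])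
    assume "n < z"
    then show ?thesis using z(2) mu.IH(1) by fastforce
  next
    assume "z < n"
    then show ?thesis using z(1) mu.IH(2) by fastforce
  qed
qed


section \<open>Well-definedness\<close>

lemma words_simps [simp]:
  "[] \<in> words d" "v @ w \<in> words d \<longleftrightarrow> v \<in> words d \<and> w \<in> words d"
  "x # w \<in> words d \<longleftrightarrow> x \<in> {1..d} \<and> w \<in> words d"
  by (auto simp: words_def)

lemma tree_adj_append: "tree_adj (u @ v) (u @ w) \<longleftrightarrow> tree_adj v w"
  by (auto simp: tree_adj_def)

lemma tree_autsD:
  assumes "g \<in> tree_auts d"
  shows "g \<in> Bij (words d)" "bij_betw g (words d) (words d)" "inj_on g (words d)"
    "g \<in> extensional (words d)" "g [] = []" "\<And>v. v \<in> words d \<Longrightarrow> g v \<in> words d"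
    "\<And>v w. v \<in> words d \<Longrightarrow> w \<in> words d \<Longrightarrow> tree_adj (g v) (g w) \<longleftrightarrow> tree_adj v w"
  using assms by (auto simp: tree_auts_def Bij_def bij_betw_def)

lemma tree_auts_one: "(\<lambda>v\<in>words d. v) \<in> tree_auts d"
  using id_Bij[of "words d"] by (auto simp: tree_auts_def)

lemma tree_auts_compose:
  assumes "g \<in> tree_auts d" "h \<in> tree_auts d"
  shows "compose (words d) h g \<in> tree_auts d"
  using assms compose_Bij[OF tree_autsD(1)[OF assms(2)] tree_autsD(1)[OF assms(1)]]
    tree_autsD[OF assms(1)] tree_autsD[OF assms(2)]
  by (auto simp: tree_auts_def compose_def)

lemma tree_auts_inv:
  assumes "g \<in> tree_auts d"
  shows "(\<lambda>v\<in>words d. inv_into (words d) g v) \<in> tree_auts d" (is "?i \<in> _")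
proof -
  note g = tree_autsD[OF assms]
  have im: "inv_into (words d) g v \<in> words d" "g (inv_into (words d) g v) = v"
    if "v \<in> words d" for v
    using that g(2) by (auto simp: bij_betw_def inv_into_into f_inv_into_f)
  have 1: "?i \<in> Bij (words d)" by (rule restrict_inv_into_Bij[OF g(1)])
  have "g (?i []) = g []" using im g by simp
  then have 2: "?i [] = []" using inj_onD[OF g(3)] im by simp
  have 3: "tree_adj (?i v) (?i w) \<longleftrightarrow> tree_adj v w" if "v \<in> words d" "w \<in> words d" for v w
    using g(7)[of "?i v" "?i w"] that im by simp
  from 1 2 3 show ?thesis unfolding tree_auts_def by blast
qed

lemma group_Aut_T: "group (Aut_T d)"
proof (rule groupI)
  fix x y z
  assume *: "x \<in> carrier (Aut_T d)" "y \<in> carrier (Aut_T d)" "z \<in> carrier (Aut_T d)"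
  then have "x \<in> words d \<rightarrow> words d" by (auto simp: Aut_T_def tree_autsD)
  from compose_assoc[OF this] show
    "x \<otimes>\<^bsub>Aut_T d\<^esub> y \<otimes>\<^bsub>Aut_T d\<^esub> z = x \<otimes>\<^bsub>Aut_T d\<^esub> (y \<otimes>\<^bsub>Aut_T d\<^esub> z)"
    using * by (simp add: Aut_T_def tree_auts_compose)
next
  fix x assume x: "x \<in> carrier (Aut_T d)"
  then have t: "x \<in> tree_auts d" by (simp add: Aut_T_def)
  show "\<one>\<^bsub>Aut_T d\<^esub> \<otimes>\<^bsub>Aut_T d\<^esub> x = x"
    using t tree_autsD(4)[OF t]
    by (auto simp: Aut_T_def tree_auts_one compose_def fun_eq_iff extensional_def)
  define y where "y = (\<lambda>v\<in>words d. inv_into (words d) x v)"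
  have y: "y \<in> tree_auts d" unfolding y_def by (rule tree_auts_inv[OF t])
  have "compose (words d) x y = (\<lambda>v\<in>words d. v)"
    using tree_autsD(2)[OF t] by (auto simp: y_def compose_def fun_eq_iff bij_betw_def f_inv_into_f)
  then show "\<exists>y\<in>carrier (Aut_T d). y \<otimes>\<^bsub>Aut_T d\<^esub> x = \<one>\<^bsub>Aut_T d\<^esub>"
    using t y by (auto simp: Aut_T_def intro!: bexI[of _ y])
qed (auto simp: Aut_T_def tree_auts_one tree_auts_compose)

lemma tree_aut_snoc:
  assumes g: "g \<in> tree_auts d" and "v @ [x] \<in> words d"
  shows "\<exists>y. g (v @ [x]) = g v @ [y]"
  using assms(2)
proof (induction v arbitrary: x rule: rev_induct)
  case Nil
  have "tree_adj (g []) (g [x])" 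
    using tree_autsD(7)[OF g, of "[]" "[x]"] Nil by (simp add: tree_adj_def)
  then show ?case using tree_autsD(5)[OF g] by (auto simp: tree_adj_def)
next
  case (snoc z u)
  then obtain y where y: "g (u @ [z]) = g u @ [y]" by auto
  have "tree_adj (g (u @ [z])) (g ((u @ [z]) @ [x]))"
    using tree_autsD(7)[OF g, of "u @ [z]" "(u @ [z]) @ [x]"] snoc.prems
    by (simp add: tree_adj_def)
  then consider y' where "g ((u @ [z]) @ [x]) = g (u @ [z]) @ [y']"
    | y' where "g (u @ [z]) = g ((u @ [z]) @ [x]) @ [y']"
    by (auto simp: tree_adj_def)
  then show ?case
  proof cases
    case 2
    with y have "g u = g ((u @ [z]) @ [x])" by simp
    then have "u = (u @ [z]) @ [x]"
      by (rule inj_onD[OF tree_autsD(3)[OF g]]) (use snoc.prems in auto)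
    then show ?thesis by simp
  qed blast
qed

lemma tree_aut_append:
  assumes g: "g \<in> tree_auts d" and "v \<in> words d" "w \<in> words d"
  shows "\<exists>u. length u = length w \<and> g (v @ w) = g v @ u"
  using assms(3)
proof (induction w rule: rev_induct)
  case (snoc x w)
  then obtain u where "length u = length w" "g (v @ w) = g v @ u" by auto
  moreover obtain y where "g ((v @ w) @ [x]) = g (v @ w) @ [y]"
    using tree_aut_snoc[OF g, of "v @ w" x] snoc.prems assms(2) by auto
  ultimately show ?case by (intro exI[of _ "u @ [y]"]) simp
qed simp

lemma state_at_exists:
  assumes g: "g \<in> tree_auts d" and v: "v \<in> words d"
  shows "\<exists>!h. h \<in> tree_auts d \<and> (\<forall>w\<in>words d. g (v @ w) = g v @ h w)"
proof (rule ex_ex1I)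
  define h where "h = (\<lambda>w\<in>words d. drop (length (g v)) (g (v @ w)))"
  have h: "g (v @ w) = g v @ h w" if "w \<in> words d" for w
    using tree_aut_append[OF g v that] that by (auto simp: h_def)
  have hw: "h w \<in> words d" if "w \<in> words d" for w
    using tree_autsD(6)[OF g, of "v @ w"] h[OF that] v that by simp
  have inj: "inj_on h (words d)"
  proof (rule inj_onI)
    fix w w' assume w: "w \<in> words d" "w' \<in> words d" "h w = h w'"
    have "v @ w = v @ w'"
      by (rule inj_onD[OF tree_autsD(3)[OF g]]) (use h v w in auto)
    then show "w = w'" by simp
  qed
  have surj: "words d \<subseteq> h ` words d"
  proof
    fix u assume u: "u \<in> words d"
    define i where "i = (\<lambda>v\<in>words d. inv_into (words d) g v)"
    have i: "i \<in> tree_auts d" unfolding i_def by (rule tree_auts_inv[OF g])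
    have gv: "g v \<in> words d" using tree_autsD(6)[OF g v] .
    have "i (g v) = v" using gv v tree_autsD(3)[OF g] by (simp add: i_def)
    then obtain w where w: "i (g v @ u) = v @ w"
      using tree_aut_append[OF i gv u] by auto
    have "w \<in> words d" using tree_autsD(6)[OF i, of "g v @ u"] gv u w by simp
    moreover have "g (i (g v @ u)) = g v @ u"
      using gv u tree_autsD(2)[OF g] by (simp add: i_def bij_betw_def f_inv_into_f)
    ultimately have "u = h w" using h[of w] w by simp
    with \<open>w \<in> words d\<close> show "u \<in> h ` words d" by simp
  qed
  have adj: "tree_adj (h w) (h w') \<longleftrightarrow> tree_adj w w'" if "w \<in> words d" "w' \<in> words d" for w w'
    using tree_autsD(7)[OF g, of "v @ w" "v @ w'"] that v h tree_adj_append by simp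
  have "h [] = []" by (simp add: h_def)
  moreover have "h \<in> Bij (words d)"
    using inj surj hw by (auto simp: Bij_def bij_betw_def h_def)
  ultimately show "\<exists>h. h \<in> tree_auts d \<and> (\<forall>w\<in>words d. g (v @ w) = g v @ h w)"
    using adj h by (intro exI[of _ h]) (auto simp: tree_auts_def)
next
  fix h h'
  assume "h \<in> tree_auts d \<and> (\<forall>w\<in>words d. g (v @ w) = g v @ h w)"
    "h' \<in> tree_auts d \<and> (\<forall>w\<in>words d. g (v @ w) = g v @ h' w)"
  then show "h = h'"
    by (intro extensionalityI[where A = "words d"]) (auto simp: tree_autsD)
qed

lemma state_at:
  assumes "g \<in> tree_auts d" "v \<in> words d"
  shows "state_at d g v \<in> tree_auts d"
    "w \<in> words d \<Longrightarrow> g (v @ w) = g v @ state_at d g v w"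
  using theI'[OF state_at_exists[OF assms]] unfolding state_at_def by auto

lemma state_at_append:
  assumes g: "g \<in> tree_auts d" and v: "v \<in> words d" and u: "u \<in> words d"
  shows "state_at d g (v @ u) = state_at d (state_at d g v) u"
proof -
  note s = state_at[OF g v] and t = state_at[OF state_at(1)[OF g v] u]
  have "g ((v @ u) @ w) = g (v @ u) @ state_at d (state_at d g v) u w" if "w \<in> words d" for w
    using s(2)[of "u @ w"] s(2)[OF u] t(2)[OF that] that u by simp
  then show ?thesis
    using the1_equality[OF state_at_exists[OF g, of "v @ u"]] v u t(1)
    unfolding state_at_def[of d g "v @ u"] by simp
qed

lemma Aut_T_order:
  assumes "g \<in> tree_auts d"
  shows "group.ord (Aut_T d) g = 0 \<longleftrightarrow> (\<forall>n>0. g [^]\<^bsub>Aut_T d\<^esub> (n::nat) \<noteq> \<one>\<^bsub>Aut_T d\<^esub>)"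
  using group.ord_eq_0[OF group_Aut_T, of g d] assms by (simp add: Aut_T_def)

lemma automaton_of_exists:
  assumes "finite_state d g"
  shows "\<exists>M. automaton_of d g M"
proof -
  from assms have g: "g \<in> tree_auts d" and fin: "finite (states d g)"
    by (auto simp: finite_state_def)
  define n where "n = card (states d g)"
  obtain q where q: "bij_betw q {..<n} (states d g)"
    using ex_bij_betw_nat_finite[OF fin] by (auto simp: n_def lessThan_atLeast0)
  define r where "r = inv_into {..<n} q"
  have r: "r s < n" "q (r s) = s" if "s \<in> states d g" for s
    using q that inv_into_into[of s q "{..<n}"]
    by (auto simp: r_def bij_betw_def f_inv_into_f)
  have "state_at d g [] = g"
    using the1_equality[OF state_at_exists[OF g, of "[]"], of g] g tree_autsD(5)[OF g]
    by (simp add: state_at_def)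
  then have init: "g \<in> states d g" by (metis imageI states_def words_simps(1))
  have step: "state_at d s [x] \<in> states d g" "s \<in> tree_auts d"
    if "s \<in> states d g" "x \<in> {1..d}" for s x
    using that state_at(1)[OF g] state_at_append[OF g, of _ "[x]", symmetric]
    by (auto simp: states_def)
  have letter: "[hd (s [x])] = s [x]" if "s \<in> states d g" "x \<in> {1..d}" for s x
    using tree_aut_append[OF step(2)[OF that], of "[]" "[x]"] that(2)
      tree_autsD(5)[OF step(2)[OF that]] by (auto simp: length_Suc_conv)
  define tab where
    "tab = map (\<lambda>i. map (\<lambda>x. (hd (q i [Suc x]), r (state_at d (q i) [Suc x]))) [0..<d]) [0..<n]"
  have qi: "q i \<in> states d g" if "i < n" for i
    using q that by (auto simp: bij_betw_def)
  have "automaton_of d g (r g, tab)"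
    unfolding automaton_of_def prod.case
  proof (intro exI[of _ q] conjI allI impI ballI)
    fix i x assume i: "i < length tab" and x: "x \<in> {1..d}"
    have "tab ! i ! (x - 1) = (hd (q i [x]), r (state_at d (q i) [x]))"
      using i x by (cases x) (simp_all add: tab_def)
    then show "case tab ! i ! (x - 1) of (y, j) \<Rightarrow>
        [y] = q i [x] \<and> j < length tab \<and> q j = state_at d (q i) [x]"
      using r step[OF qi _ , of i x] letter[OF qi, of i x] i x by (simp add: tab_def)
  qed (use q r[OF init] in \<open>auto simp: tab_def\<close>)
  then show ?thesis by blast
qed

end

theory Submission
  imports Defs
begin

text \<open>
  Let \<open>a\<close> be a finite-state automorphism. The algorithm searches in parallel for a proof that \<open>a\<close> has
  finite order and for a proof that it has infinite order.

  For finite order the proof is a number \<open>n > 0\<close> with \<open>a ^^ n = id\<close>. This can be decided, because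
  two automorphisms with finitely many states agree as soon as they agree on one level whose depth
  is at least the number of pairs of their states (\<open>tree_aut_eq_if_eq_on_level\<close>). The least such \<open>n\<close>
  is the order.

  For infinite order the proof is a certificate: numbers \<open>m\<close>, \<open>l\<close> and words \<open>v\<close>, \<open>u\<close> such that \<open>a ^^ m\<close> fixes \<open>v\<close>
  but not \<open>v @ u\<close>, while \<open>a ^^ (m * l)\<close> fixes \<open>v @ u\<close> and has there the same section as \<open>a ^^ m\<close> has at \<open>v\<close>. In
  terms of \<open>g\<close>, the section of \<open>a ^^ m\<close> at \<open>v\<close>: a proper power of \<open>g\<close> reproduces \<open>g\<close> on the subtree of a word
  that \<open>g\<close> moves. If \<open>g\<close> had finite order, that order would divide a proper divisor of itself
  (\<open>infinite_order_if_certificate\<close>). A certificate can again be checked on a finite level.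

  It remains to see that a bounded \<open>a\<close> of infinite order has a certificate (\<open>certificate_exists\<close>). Let
  \<open>m\<close> be the period of a word \<open>v\<close> under \<open>a\<close>. The section of \<open>a ^^ m\<close> at \<open>v\<close> is the product of the sections of \<open>a\<close>
  along the orbit of \<open>v\<close>. By boundedness only boundedly many of these factors are nontrivial, so
  finitely many automorphisms occur as such return sections (\<open>finite_return_sections\<close>). In infinite
  order the periods are unbounded. As they grow along a word by a factor of at most \<open>d\<close> per letter,
  some word has more growth steps than there are return sections, and so two of its prefixes have
  the same return section and different periods. They form a certificate.

  On the side of computability, words of a fixed length are coded as numbers in base \<open>d\<close>, the action
  of the automaton on them becomes an iterated arithmetic operation, and both tests become
  arithmetic formulas with bounded quantifiers.
\<close>

section \<open>Recursive functions and decidable predicates of several variables\<close>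

text \<open>
  The arguments are presented as an environment \<open>e\<close>, with \<open>e i\<close> for the \<open>i\<close>-th of them, and not as
  a list: when a bound variable is put in front, the older variables become \<open>\<lambda>i. e (Suc i)\<close>, which
  beta-reduction turns back into plain accesses \<open>e (Suc i)\<close>. The closure rules below therefore
  apply by resolution alone, and proving that a composite predicate is decidable is one
  call of \<open>intro recursive_intros\<close>.
\<close>
definition recursive :: "nat \<Rightarrow> ((nat \<Rightarrow> nat) \<Rightarrow> nat) \<Rightarrow> bool" where
  "recursive n F \<longleftrightarrow> (\<exists>r. \<forall>xs. length xs = n \<longrightarrow> rec_eval r xs (F ((!) xs)))"

definition decidable :: "nat \<Rightarrow> ((nat \<Rightarrow> nat) \<Rightarrow> bool) \<Rightarrow> bool" where
  "decidable n P \<longleftrightarrow> recursive n (\<lambda>e. of_bool (P e))"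

named_theorems recursive_intros

lemma recursive_var [recursive_intros]: "i < n \<Longrightarrow> recursive n (\<lambda>e. e i)"
  unfolding recursive_def by (rule exI[of _ "Proj i"]) (auto intro: rec_eval.proj)

lemma recursive_substitute:
  assumes G: "recursive (length Fs) G" and Fs: "\<forall>F\<in>set Fs. recursive n F"
  shows "recursive n (\<lambda>e. G ((!) (map (\<lambda>F. F e) Fs)))"
proof -
  from G obtain r where
    r: "\<And>ys. length ys = length Fs \<Longrightarrow> rec_eval r ys (G ((!) ys))"
    unfolding recursive_def by blast
  have "\<exists>h. \<forall>F\<in>set Fs. \<forall>xs. length xs = n \<longrightarrow> rec_eval (h F) xs (F ((!) xs))"
    using Fs unfolding recursive_def by (intro bchoice) blast
  then obtain h where
    h: "\<And>F xs. F \<in> set Fs \<Longrightarrow> length xs = n \<Longrightarrow> rec_eval (h F) xs (F ((!) xs))"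
    by blast
  have "rec_eval (Comp r (map h Fs)) xs (G ((!) (map (\<lambda>F. F ((!) xs)) Fs)))"
    if "length xs = n" for xs
    by (rule rec_eval.comp[of "map (\<lambda>F. F ((!) xs)) Fs"]) (use that r h in auto)
  then show ?thesis unfolding recursive_def by blast
qed

lemma recursive_compose1:
  assumes "recursive 1 (\<lambda>e. g (e 0))" "recursive n F"
  shows "recursive n (\<lambda>e. g (F e))"
  using recursive_substitute[of "[F]" "\<lambda>e. g (e 0)" n] assms by simp

lemma recursive_compose2:
  assumes "recursive 2 (\<lambda>e. g (e 0) (e 1))" "recursive n F" "recursive n G"
  shows "recursive n (\<lambda>e. g (F e) (G e))"
  using recursive_substitute[of "[F, G]" "\<lambda>e. g (e 0) (e 1)" n] assms
  by (simp add: numeral_2_eq_2)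

lemma recursive_compose3:
  assumes "recursive 3 (\<lambda>e. g (e 0) (e 1) (e 2))"
    "recursive n F" "recursive n G" "recursive n H"
  shows "recursive n (\<lambda>e. g (F e) (G e) (H e))"
  using recursive_substitute[of "[F, G, H]" "\<lambda>e. g (e 0) (e 1) (e 2)" n] assms
  by (simp add: numeral_eq_Suc)

lemma recursive_Suc [recursive_intros]:
  assumes "recursive n F" shows "recursive n (\<lambda>e. Suc (F e))"
proof (rule recursive_compose1[OF _ assms])
  have "rec_eval Succ xs (Suc (xs ! 0))" if "length xs = 1" for xs
    using that rec_eval.succ by (cases xs) auto
  then show "recursive 1 (\<lambda>e. Suc (e 0))" unfolding recursive_def by blast
qed

lemma recursive_const [recursive_intros]: "recursive n (\<lambda>e. c)"
proof (induction c)
  case 0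
  show ?case unfolding recursive_def using rec_eval.zero by blast
qed (rule recursive_Suc)

text \<open>
  Only the predecessor needs this general form, in which the step reads the counter; all other
  recursions are iterations.
\<close>
lemma recursive_rec_nat:
  assumes B: "recursive n B"
    and S: "recursive (Suc (Suc n)) (\<lambda>e. S (e 0) (e (Suc 0)) (\<lambda>i. e (Suc (Suc i))))"
    and N: "recursive n N"
  shows "recursive n (\<lambda>e. rec_nat (B e) (\<lambda>k y. S k y e) (N e))"
proof -
  from B obtain rb where
    rb: "\<And>xs. length xs = n \<Longrightarrow> rec_eval rb xs (B ((!) xs))"
    unfolding recursive_def by blast
  from S obtain rs where rs': "\<And>ys. length ys = Suc (Suc n) \<Longrightarrow>
      rec_eval rs ys (S (ys ! 0) (ys ! Suc 0) (\<lambda>i. ys ! Suc (Suc i)))"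
    unfolding recursive_def by blast
  have rs: "rec_eval rs (k # y # xs) (S k y ((!) xs))" if "length xs = n" for k y xs
    using rs'[of "k # y # xs"] that by simp
  from N obtain rn where
    rn: "\<And>xs. length xs = n \<Longrightarrow> rec_eval rn xs (N ((!) xs))"
    unfolding recursive_def by blast
  have pr: "rec_eval (PrimRec rb rs) (k # xs) (rec_nat (B ((!) xs)) (\<lambda>k y. S k y ((!) xs)) k)"
    if "length xs = n" for xs k
    by (induction k) (auto intro: rec_eval.primrec_0 rec_eval.primrec_Suc rb rs that)
  have "rec_eval (Comp (PrimRec rb rs) (rn # map Proj [0..<n])) xs
      (rec_nat (B ((!) xs)) (\<lambda>k y. S k y ((!) xs)) (N ((!) xs)))"
    if xs: "length xs = n" for xs
  proof (rule rec_eval.comp[of "N ((!) xs) # xs"])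
    show "\<forall>i<length (rn # map Proj [0..<n]).
        rec_eval ((rn # map Proj [0..<n]) ! i) xs ((N ((!) xs) # xs) ! i)"
      using xs rn by (auto simp: nth_Cons split: nat.split intro: rec_eval.proj)
  qed (use xs pr in auto)
  then show ?thesis unfolding recursive_def by blast
qed

lemma recursive_funpow [recursive_intros]:
  assumes "recursive (Suc (Suc n)) (\<lambda>e. S (\<lambda>i. e (Suc (Suc i))) (e (Suc 0)))"
    and "recursive n N" and "recursive n B"
  shows "recursive n (\<lambda>e. (S e ^^ N e) (B e))"
proof -
  have "(f ^^ k) b = rec_nat b (\<lambda>_. f) k" for f :: "nat \<Rightarrow> nat" and k b
    by (induction k) auto
  then show ?thesis
    using recursive_rec_nat[of n B "\<lambda>k y e. S e y" N] assms by simp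
qed

lemma recursive_add [recursive_intros]:
  assumes "recursive n F" "recursive n G" shows "recursive n (\<lambda>e. F e + G e)"
proof -
  have "(Suc ^^ k) b = k + b" for k b by (induction k) auto
  then show ?thesis
    using recursive_funpow[of n "\<lambda>_. Suc" F G] assms recursive_Suc[OF recursive_var] by simp
qed

lemma recursive_diff [recursive_intros]:
  assumes "recursive n F" "recursive n G" shows "recursive n (\<lambda>e. F e - G e)"
proof -
  have pred: "recursive 1 (\<lambda>e. rec_nat 0 (\<lambda>k y. k) (e 0))"
    by (rule recursive_rec_nat[where S = "\<lambda>k y e. k"]) (intro recursive_intros; simp)+
  have "rec_nat 0 (\<lambda>k y. k) m = m - 1" for m by (cases m) auto
  with pred have pred1: "recursive 1 (\<lambda>e. e 0 - 1)" by simp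
  have "((\<lambda>x. x - 1) ^^ k) b = b - k" for k b :: nat by (induction k) auto
  then show ?thesis
    using recursive_funpow[of n "\<lambda>_ x. x - 1" G F] assms
      recursive_compose1[OF pred1 recursive_var[of "Suc 0" "Suc (Suc n)"]]
    by simp
qed

lemma recursive_mult [recursive_intros]:
  assumes "recursive n F" "recursive n G" shows "recursive n (\<lambda>e. F e * G e)"
proof (rule recursive_compose2[OF _ assms])
  have "((+) c ^^ k) 0 = k * c" for k c :: nat by (induction k) auto
  moreover have "recursive 2 (\<lambda>e. ((+) (e 1) ^^ e 0) 0)"
    by (intro recursive_intros; simp)
  ultimately show "recursive 2 (\<lambda>e. e 0 * e 1)" by simp
qed

lemma recursive_power [recursive_intros]:
  assumes "recursive n F" "recursive n G" shows "recursive n (\<lambda>e. F e ^ G e)"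
proof (rule recursive_compose2[OF _ assms])
  have "((*) c ^^ k) 1 = c ^ k" for k c :: nat by (induction k) auto
  moreover have "recursive 2 (\<lambda>e. ((*) (e 0) ^^ e 1) 1)"
    by (intro recursive_intros; simp)
  ultimately show "recursive 2 (\<lambda>e. e 0 ^ e 1)" by simp
qed

lemma decidable_le [recursive_intros]:
  assumes "recursive n F" "recursive n G" shows "decidable n (\<lambda>e. F e \<le> G e)"
proof -
  have "of_bool (x \<le> y) = 1 - (x - y)" for x y :: nat by auto
  then show ?thesis unfolding decidable_def using assms by (simp only:) (intro recursive_intros)
qed

lemma decidable_not [recursive_intros]:
  assumes "decidable n P" shows "decidable n (\<lambda>e. \<not> P e)"
proof -
  have "of_bool (\<not> b) = 1 - (of_bool b :: nat)" for b by simp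
  then show ?thesis using recursive_diff[OF recursive_const[of n 1]] assms
    unfolding decidable_def by simp
qed

lemma decidable_conj [recursive_intros]:
  assumes "decidable n P" "decidable n Q" shows "decidable n (\<lambda>e. P e \<and> Q e)"
  using assms unfolding decidable_def of_bool_conj by (intro recursive_intros)

lemma decidable_disj [recursive_intros]:
  assumes "decidable n P" "decidable n Q" shows "decidable n (\<lambda>e. P e \<or> Q e)"
  using decidable_not[OF decidable_conj[OF decidable_not[OF assms(1)] decidable_not[OF assms(2)]]]
  by simp

lemma decidable_eq [recursive_intros]:
  assumes "recursive n F" "recursive n G" shows "decidable n (\<lambda>e. F e = G e)"
  using decidable_conj[OF decidable_le[OF assms] decidable_le[OF assms(2,1)]]
  by (simp add: eq_iff)

lemma decidable_less [recursive_intros]: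
  assumes "recursive n F" "recursive n G" shows "decidable n (\<lambda>e. F e < G e)"
  using decidable_le[OF recursive_Suc[OF assms(1)] assms(2)] by (simp add: Suc_le_eq)

lemma recursive_if [recursive_intros]:
  assumes "decidable n P" "recursive n F" "recursive n G"
  shows "recursive n (\<lambda>e. if P e then F e else G e)"
proof -
  have "(if P e then F e else G e) = of_bool (P e) * F e + of_bool (\<not> P e) * G e" for e by simp
  then show ?thesis
    using assms decidable_not[OF assms(1)] unfolding decidable_def
    by (simp only:) (intro recursive_intros)
qed

text \<open>
  Stated for one argument list at a time, since a search that may diverge elsewhere is not an
  instance of \<open>recursive_Least\<close> below.
\<close>
lemma rec_eval_Mu_Least:
  assumes r: "\<And>k. rec_eval r (k # xs) (of_bool (\<not> P k))" and ex: "\<exists>k. P k"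
  shows "rec_eval (Mu r) xs (LEAST k. P k)"
proof (rule rec_eval.mu)
  show "rec_eval r ((LEAST k. P k) # xs) 0"
    using r[of "LEAST k. P k"] LeastI_ex[OF ex] by simp
  show "\<forall>m<LEAST k. P k. \<exists>y. rec_eval r (m # xs) (Suc y)"
    using r not_less_Least[of _ P] by (metis One_nat_def of_bool_eq(2))
qed

lemma recursive_Least:
  assumes P: "decidable (Suc n) (\<lambda>e. P (e 0) (\<lambda>i. e (Suc i)))" and ex: "\<And>e. \<exists>k. P k e"
  shows "recursive n (\<lambda>e. LEAST k. P k e)"
proof -
  from decidable_not[OF P] obtain r where
    "\<And>xs. length xs = Suc n \<Longrightarrow> rec_eval r xs (of_bool (\<not> P (xs ! 0) (\<lambda>i. xs ! Suc i)))"
    unfolding decidable_def recursive_def by blast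
  note r = this
  have "rec_eval r (k # xs) (of_bool (\<not> P k ((!) xs)))" if "length xs = n" for k xs
    using r[of "k # xs"] that by simp
  then have "rec_eval (Mu r) xs (LEAST k. P k ((!) xs))" if "length xs = n" for xs
    using that by (intro rec_eval_Mu_Least ex)
  then show ?thesis
    unfolding recursive_def by blast
qed

lemma decidable_all_less [recursive_intros]:
  assumes "decidable (Suc n) (\<lambda>e. P (e 0) (\<lambda>i. e (Suc i)))" and B: "recursive n B"
  shows "decidable n (\<lambda>e. \<forall>k<B e. P k e)"
proof -
  obtain rb where rb: "\<And>xs. length xs = n \<Longrightarrow> rec_eval rb xs (B ((!) xs))"
    using B unfolding recursive_def by blast
  have "rec_eval (Comp rb (map Proj [1..<Suc n])) xs (B (\<lambda>i. xs ! Suc i))"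
    if xs: "length xs = Suc n" for xs
  proof -
    obtain x ys where "xs = x # ys" "length ys = n" using xs by (cases xs) auto
    then show ?thesis
      by (intro rec_eval.comp[of ys]) (auto intro!: rec_eval.proj[of "Suc _" "x # ys", simplified] rb simp del: upt_Suc)
  qed
  then have B': "recursive (Suc n) (\<lambda>e. B (\<lambda>i. e (Suc i)))" unfolding recursive_def by blast
  \<comment> \<open>The search for a counterexample is stopped at the bound, which makes it total; the statement
    holds iff the search runs into the bound.\<close>
  have "recursive n (\<lambda>e. LEAST k. B e \<le> k \<or> \<not> P k e)"
  proof (rule recursive_Least)
    show "\<exists>k. B e \<le> k \<or> \<not> P k e" for e by (rule exI[of _ "B e"]) simp
  qed (rule decidable_disj decidable_le decidable_not recursive_var assms B' zero_less_Suc)+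
  then have "decidable n (\<lambda>e. B e \<le> (LEAST k. B e \<le> k \<or> \<not> P k e))"
    by (rule decidable_le[OF B])
  moreover have "b \<le> (LEAST k. b \<le> k \<or> \<not> p k) \<longleftrightarrow> (\<forall>k<b. p k)" for b :: nat and p
  proof (intro iffI allI impI)
    fix k assume "b \<le> (LEAST k. b \<le> k \<or> \<not> p k)" "k < b"
    then show "p k" using not_less_Least[of k "\<lambda>k. b \<le> k \<or> \<not> p k"] by linarith
  next
    assume "\<forall>k<b. p k"
    then show "b \<le> (LEAST k. b \<le> k \<or> \<not> p k)"
      using LeastI[of "\<lambda>k. b \<le> k \<or> \<not> p k" b] by (meson not_le_imp_less order_refl)
  qed
  ultimately show ?thesis by simp
qed

lemma decidable_ex_less [recursive_intros]:
  assumes "decidable (Suc n) (\<lambda>e. P (e 0) (\<lambda>i. e (Suc i)))" "recursive n B"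
  shows "decidable n (\<lambda>e. \<exists>k<B e. P k e)"
  using decidable_not[OF decidable_all_less[OF decidable_not[OF assms(1)] assms(2)]] by simp

lemma recursive_div [recursive_intros]:
  assumes "recursive n F" "recursive n G" shows "recursive n (\<lambda>e. F e div G e)"
proof (rule recursive_compose2[OF _ assms])
  \<comment> \<open>The first disjunct stops the search at \<open>0\<close>, the value of a quotient by \<open>0\<close>.\<close>
  have "recursive 2 (\<lambda>e. LEAST q. e 1 = 0 \<or> e 0 < Suc q * e 1)"
  proof (rule recursive_Least)
    fix e :: "nat \<Rightarrow> nat"
    have "e 1 = 0 \<or> e 0 < Suc (e 0) * e 1" by (cases "e 1") auto
    then show "\<exists>q. e 1 = 0 \<or> e 0 < Suc q * e 1" by blast
  qed (intro recursive_intros; simp)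
  moreover have "(LEAST q. y = 0 \<or> x < Suc q * y) = x div y" for x y :: nat
  proof (rule Least_equality)
    show "y = 0 \<or> x < Suc (x div y) * y" using dividend_less_div_times[of y x] by auto
  next
    fix q assume "y = 0 \<or> x < Suc q * y"
    then show "x div y \<le> q" using less_mult_imp_div_less[of x "Suc q" y] by auto
  qed
  ultimately show "recursive 2 (\<lambda>e. e 0 div e 1)" by simp
qed

lemma recursive_mod [recursive_intros]:
  assumes "recursive n F" "recursive n G" shows "recursive n (\<lambda>e. F e mod G e)"
  using assms unfolding minus_div_mult_eq_mod[symmetric] by (intro recursive_intros)

lemma recursive_prod_encode [recursive_intros]:
  assumes "recursive n F" "recursive n G" shows "recursive n (\<lambda>e. prod_encode (F e, G e))"
  using assms unfolding prod_encode_def triangle_def prod.case by (intro recursive_intros)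

lemma Least_eq: "(LEAST x. x = c) = c" for c :: nat
  by (rule Least_equality) simp_all

lemma recursive_fst_decode [recursive_intros]:
  assumes "recursive n F" shows "recursive n (\<lambda>e. fst (prod_decode (F e)))"
proof (rule recursive_compose1[OF _ assms])
  have *: "x = fst (prod_decode z) \<longleftrightarrow> (\<exists>y<Suc z. prod_encode (x, y) = z)" for x z
  proof
    assume "x = fst (prod_decode z)"
    then have "prod_encode (x, snd (prod_decode z)) = z" by simp
    then show "\<exists>y<Suc z. prod_encode (x, y) = z" by (metis le_prod_encode_2 less_Suc_eq_le)
  qed auto
  have "recursive 1 (\<lambda>e. LEAST x. \<exists>y<Suc (e 0). prod_encode (x, y) = e 0)"
    by (rule recursive_Least) ((intro recursive_intros; simp), unfold *[symmetric], rule exI, rule refl)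
  then show "recursive 1 (\<lambda>e. fst (prod_decode (e 0)))"
    unfolding *[symmetric] Least_eq .
qed

lemma recursive_snd_decode [recursive_intros]:
  assumes "recursive n F" shows "recursive n (\<lambda>e. snd (prod_decode (F e)))"
proof (rule recursive_compose1[OF _ assms])
  have *: "y = snd (prod_decode z) \<longleftrightarrow> prod_encode (fst (prod_decode z), y) = z" for y z
  proof
    assume "prod_encode (fst (prod_decode z), y) = z"
    then have "prod_decode z = (fst (prod_decode z), y)" by (metis prod_encode_inverse)
    then show "y = snd (prod_decode z)" by (metis snd_conv)
  qed simp
  have "recursive 1 (\<lambda>e. LEAST y. prod_encode (fst (prod_decode (e 0)), y) = e 0)"
    by (rule recursive_Least) ((intro recursive_intros; simp), unfold *[symmetric], rule exI, rule refl)
  then show "recursive 1 (\<lambda>e. snd (prod_decode (e 0)))"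
    unfolding *[symmetric] Least_eq .
qed

text \<open>
  A nonempty list is encoded as the successor of a pair of head and tail.
\<close>
definition code_nth :: "nat \<Rightarrow> nat \<Rightarrow> nat" where
  "code_nth c i = fst (prod_decode (((\<lambda>z. snd (prod_decode (z - 1))) ^^ i) c - 1))"

lemma code_nth_list_encode: "i < length xs \<Longrightarrow> code_nth (list_encode xs) i = xs ! i"
proof (induction i arbitrary: xs)
  case 0
  then show ?case by (cases xs) (simp_all add: code_nth_def)
next
  case (Suc i)
  then obtain x ys where xs: "xs = x # ys" by (cases xs) auto
  have "code_nth (list_encode xs) (Suc i) = code_nth (list_encode ys) i"
    by (simp add: code_nth_def xs funpow_Suc_right del: funpow.simps)
  with Suc xs show ?case by simp
qed

lemma recursive_code_nth [recursive_intros]: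
  assumes "recursive n F" "recursive n G" shows "recursive n (\<lambda>e. code_nth (F e) (G e))"
  by (rule recursive_compose2[OF _ assms]) (unfold code_nth_def, intro recursive_intros; simp)

lemma length_le_list_encode: "length xs \<le> list_encode xs"
proof (induction xs)
  case (Cons x xs)
  then show ?case using le_prod_encode_2[of "list_encode xs" x] by simp
qed simp

section \<open>Sections of powers of a tree automorphism\<close>

definition tree_id :: "nat \<Rightarrow> nat list \<Rightarrow> nat list" where
  "tree_id d = (\<lambda>v\<in>words d. v)"

lemma tree_id_apply [simp]: "v \<in> words d \<Longrightarrow> tree_id d v = v"
  by (simp add: tree_id_def)

lemma tree_id_tree_auts [simp]: "tree_id d \<in> tree_auts d"
  unfolding tree_id_def by (rule tree_auts_one)

lemma tree_aut_length:
  assumes "g \<in> tree_auts d" "w \<in> words d" shows "length (g w) = length w"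
  using tree_aut_append[OF assms(1), of "[]" w] tree_autsD(5)[OF assms(1)] assms(2) by auto

lemma tree_aut_eqI:
  assumes "g \<in> tree_auts d" "h \<in> tree_auts d" "\<And>w. w \<in> words d \<Longrightarrow> g w = h w"
  shows "g = h"
  using assms by (intro extensionalityI[where A = "words d"]) (auto simp: tree_autsD)

lemma state_at_eqI:
  assumes "g \<in> tree_auts d" "v \<in> words d" "h \<in> tree_auts d"
    and "\<And>w. w \<in> words d \<Longrightarrow> g (v @ w) = g v @ h w"
  shows "state_at d g v = h"
  using state_at[OF assms(1,2)] assms by (intro tree_aut_eqI) auto

lemma state_at_compose:
  assumes g: "g \<in> tree_auts d" and h: "h \<in> tree_auts d" and v: "v \<in> words d"
  shows "state_at d (compose (words d) h g) v
    = compose (words d) (state_at d h (g v)) (state_at d g v)"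
proof -
  have gv: "g v \<in> words d" using tree_autsD(6)[OF g v] .
  note sg = state_at[OF g v] and sh = state_at[OF h gv]
  show ?thesis
    using g h v gv sg sh tree_autsD(6)[OF sg(1)]
    by (intro state_at_eqI tree_auts_compose) (auto simp: compose_def)
qed

lemma state_at_id: "v \<in> words d \<Longrightarrow> state_at d (tree_id d) v = tree_id d"
  by (rule state_at_eqI) auto

lemma states_tree_id: "states d (tree_id d) = {tree_id d}"
proof -
  have "states d (tree_id d) = (\<lambda>v. tree_id d) ` words d"
    unfolding states_def by (rule image_cong) (simp_all add: state_at_id)
  then show ?thesis by (auto intro: words_simps(1))
qed

lemma states_state_at:
  assumes "g \<in> tree_auts d" "v \<in> words d"
  shows "states d (state_at d g v) \<subseteq> states d g"
  unfolding states_def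
proof
  fix s assume "s \<in> state_at d (state_at d g v) ` words d"
  then obtain u where "u \<in> words d" "s = state_at d (state_at d g v) u" by blast
  then have "s = state_at d g (v @ u)" "v @ u \<in> words d"
    using state_at_append[OF assms] assms by auto
  then show "s \<in> state_at d g ` words d" by blast
qed

lemma states_tree_auts: "g \<in> tree_auts d \<Longrightarrow> s \<in> states d g \<Longrightarrow> s \<in> tree_auts d"
  using state_at(1) by (auto simp: states_def)

text \<open>
  The function iterate carries no extensionality condition and is easier to compute with than the
  power in the group; restricting it to words yields the group element.
\<close>
definition aut_power :: "nat \<Rightarrow> (nat list \<Rightarrow> nat list) \<Rightarrow> nat \<Rightarrow> nat list \<Rightarrow> nat list" where
  "aut_power d a n = (\<lambda>v\<in>words d. (a ^^ n) v)"

lemma funpow_words: "a \<in> tree_auts d \<Longrightarrow> v \<in> words d \<Longrightarrow> (a ^^ n) v \<in> words d"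
  by (induction n) (auto simp: tree_autsD)

lemma funpow_length:
  "a \<in> tree_auts d \<Longrightarrow> v \<in> words d \<Longrightarrow> length ((a ^^ n) v) = length v"
  by (induction n) (auto simp: tree_aut_length funpow_words)

lemma aut_power_0: "aut_power d a 0 = tree_id d"
  by (simp add: aut_power_def tree_id_def)

lemma aut_power_Suc:
  "a \<in> tree_auts d \<Longrightarrow> aut_power d a (Suc n) = compose (words d) a (aut_power d a n)"
  by (auto simp: aut_power_def compose_def)

lemma aut_power_tree_auts: "a \<in> tree_auts d \<Longrightarrow> aut_power d a n \<in> tree_auts d"
  by (induction n) (auto simp: aut_power_0 aut_power_Suc tree_auts_compose)

lemma aut_power_apply: "v \<in> words d \<Longrightarrow> aut_power d a n v = (a ^^ n) v"
  by (simp add: aut_power_def)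

lemma Aut_T_pow:
  assumes "a \<in> tree_auts d" shows "a [^]\<^bsub>Aut_T d\<^esub> n = aut_power d a n"
proof (induction n)
  case 0
  then show ?case by (simp add: aut_power_0 Aut_T_def tree_id_def)
next
  case (Suc n)
  then show ?case using assms aut_power_tree_auts[OF assms, of n]
    by (simp add: aut_power_Suc Aut_T_def)
qed

lemma ord_dvd_iff_aut_power:
  assumes "a \<in> tree_auts d"
  shows "group.ord (Aut_T d) a dvd n \<longleftrightarrow> aut_power d a n = tree_id d"
  using group.pow_eq_id[OF group_Aut_T, of a d n] assms Aut_T_pow[OF assms]
  by (simp add: Aut_T_def tree_id_def)

lemma aut_power_eq_id_iff:
  "a \<in> tree_auts d \<Longrightarrow> aut_power d a n = tree_id d \<longleftrightarrow> (\<forall>w\<in>words d. (a ^^ n) w = w)"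
  by (auto simp: aut_power_def tree_id_def fun_eq_iff)

lemma funpow_append:
  assumes "a \<in> tree_auts d" "v \<in> words d" "w \<in> words d"
  shows "(a ^^ n) (v @ w) = (a ^^ n) v @ state_at d (aut_power d a n) v w"
  using state_at(2)[OF aut_power_tree_auts[OF assms(1)] assms(2,3), of n] assms
  by (simp add: aut_power_apply)

lemma state_at_aut_power_Suc:
  assumes "a \<in> tree_auts d" "v \<in> words d"
  shows "state_at d (aut_power d a (Suc n)) v
    = compose (words d) (state_at d a ((a ^^ n) v)) (state_at d (aut_power d a n) v)"
  using assms by (simp add: aut_power_Suc state_at_compose aut_power_tree_auts aut_power_apply)

text \<open>
  A section of \<open>a ^^ n\<close> is a product of \<open>n\<close> sections of \<open>a\<close>.
\<close>
lemma states_aut_power: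
  assumes "finite_state d a"
  shows "finite (states d (aut_power d a n)) \<and>
    card (states d (aut_power d a n)) \<le> card (states d a) ^ n"
proof (induction n)
  case 0
  then show ?case by (simp add: aut_power_0 states_tree_id)
next
  case (Suc n)
  have a: "a \<in> tree_auts d" and fin: "finite (states d a)"
    using assms by (auto simp: finite_state_def)
  let ?A = "states d a \<times> states d (aut_power d a n)"
  have sub: "states d (aut_power d a (Suc n)) \<subseteq> (\<lambda>(s, f). compose (words d) s f) ` ?A"
    using a by (force simp: states_def state_at_aut_power_Suc funpow_words)
  have fA: "finite ?A" using Suc fin by simp
  have "card (states d (aut_power d a (Suc n))) \<le> card ?A"
    by (rule surj_card_le[OF fA sub])
  also have "\<dots> \<le> card (states d a) ^ Suc n"
    using Suc by (simp add: card_cartesian_product)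
  finally show ?case using finite_subset[OF sub finite_imageI[OF fA]] by blast
qed

section \<open>Equality of automorphisms is visible on a finite level\<close>

text \<open>
  Consider a shortest word \<open>w\<close> on which \<open>g\<close> and \<open>h\<close> differ. If it were longer than the number of pairs
  of states, two proper prefixes of \<open>w\<close> would lead to the same pair, and cutting out the piece
  between them would produce a shorter such word.
\<close>
lemma tree_aut_eq_if_eq_on_level:
  assumes d: "d \<ge> 1" and g: "g \<in> tree_auts d" and h: "h \<in> tree_auts d"
    and fin: "finite (states d g)" "finite (states d h)"
    and K: "card (states d g) * card (states d h) \<le> K"
    and eq: "\<And>w. w \<in> words d \<Longrightarrow> length w = K \<Longrightarrow> g w = h w"
  shows "g = h"
proof (rule ccontr)
  assume "g \<noteq> h"
  then have "\<exists>w. w \<in> words d \<and> g w \<noteq> h w" using tree_aut_eqI[OF g h] by blast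
  then obtain w where w: "w \<in> words d" "g w \<noteq> h w"
    and shortest: "\<And>u. u \<in> words d \<Longrightarrow> length u < length w \<Longrightarrow> g u = h u"
    using exists_least_iff[of "\<lambda>k. \<exists>w. w \<in> words d \<and> g w \<noteq> h w \<and> length w = k"] by metis
  \<comment> \<open>A shorter \<open>w\<close> could be extended to level \<open>K\<close>; this is where the alphabet must be nonempty.\<close>
  have "K < length w"
  proof (rule ccontr)
    assume "\<not> K < length w"
    define u where "u = replicate (K - length w) (1::nat)"
    have u: "u \<in> words d" "length (w @ u) = K"
      using d \<open>\<not> K < length w\<close> by (auto simp: u_def words_def)
    then have "g w @ state_at d g w u = h w @ state_at d h w u"
      using eq[of "w @ u"] w(1) state_at(2)[OF g w(1)] state_at(2)[OF h w(1)] by simp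
    then show False using w tree_aut_length[OF g w(1)] tree_aut_length[OF h w(1)] by simp
  qed
  define st where "st i = (state_at d g (take i w), state_at d h (take i w))" for i
  have tk: "take i w \<in> words d" for i
    using w(1) by (metis append_take_drop_id words_simps(2))
  have "st ` {..<length w} \<subseteq> states d g \<times> states d h"
    using tk by (auto simp: st_def states_def)
  then have "card (st ` {..<length w}) \<le> card (states d g \<times> states d h)"
    using fin by (intro card_mono) auto
  also have "\<dots> < card {..<length w}" using K \<open>K < length w\<close> by (simp add: card_cartesian_product)
  finally have "\<not> inj_on st {..<length w}" using pigeonhole by blast
  then obtain i j where ij: "i < j" "j < length w" "st i = st j"
    unfolding inj_on_def by (metis lessThan_iff linorder_neqE_nat)
  let ?p = "take i w" and ?q = "take j w" and ?r = "drop j w"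
  have r: "?r \<in> words d" using w(1) by (metis append_take_drop_id words_simps(2))
  have wqr: "w = ?q @ ?r" by simp
  have "g (?q @ ?r) = g ?q @ state_at d g ?q ?r" "h (?q @ ?r) = h ?q @ state_at d h ?q ?r"
    by (intro state_at(2) g h tk r)+
  moreover have "g ?q = h ?q" using ij shortest[OF tk] by simp
  ultimately have neq: "state_at d g ?q ?r \<noteq> state_at d h ?q ?r" using w(2) wqr by metis
  have "g (?p @ ?r) = h (?p @ ?r)"
    by (rule shortest) (use tk r ij in auto)
  moreover have "g ?p = h ?p" using ij shortest[OF tk] by simp
  moreover have "g (?p @ ?r) = g ?p @ state_at d g ?p ?r" "h (?p @ ?r) = h ?p @ state_at d h ?p ?r"
    by (intro state_at(2) g h tk r)+
  ultimately have "state_at d g ?p ?r = state_at d h ?p ?r" by simp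
  with neq ij(3) show False by (simp add: st_def)
qed

section \<open>Periods\<close>

definition period :: "('a \<Rightarrow> 'a) \<Rightarrow> 'a \<Rightarrow> nat" where
  "period f x = (LEAST m. m > 0 \<and> (f ^^ m) x = x)"

lemma period_LeastI:
  assumes "m > 0" "(f ^^ m) x = x"
  shows "period f x > 0" "(f ^^ period f x) x = x" "period f x \<le> m"
  using LeastI[of "\<lambda>m. m > 0 \<and> (f ^^ m) x = x" m]
    Least_le[of "\<lambda>m. m > 0 \<and> (f ^^ m) x = x" m] assms
  by (auto simp: period_def)

lemma funpow_mult_fixed: "(f ^^ m) x = x \<Longrightarrow> (f ^^ (m * k)) x = x"
  by (induction k) (simp_all add: funpow_add)

lemma period_dvd:
  assumes "(f ^^ k) x = x" shows "period f x dvd k"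
proof (cases "k = 0")
  case False
  then have p: "period f x > 0" "(f ^^ period f x) x = x"
    using period_LeastI[of k f x] assms by auto
  have "(f ^^ k) x = (f ^^ (k mod period f x)) ((f ^^ (period f x * (k div period f x))) x)"
    by (metis comp_apply funpow_add mod_mult_div_eq)
  then have "(f ^^ (k mod period f x)) x = x"
    using assms funpow_mult_fixed[OF p(2)] by simp
  then have "k mod period f x = 0"
    using period_LeastI(3)[of "k mod period f x" f x] p(1) mod_less_divisor[OF p(1), of k]
    by (meson gr0I leD)
  then show ?thesis by auto
qed simp

text \<open>
  If \<open>a ^^ m\<close> returns to \<open>v\<close>, it acts on the subtree below \<open>v\<close> through its section there.
\<close>
lemma funpow_return:
  assumes a: "a \<in> tree_auts d" and v: "v \<in> words d" and m: "(a ^^ m) v = v" and w: "w \<in> words d"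
  shows "(a ^^ (m * j)) (v @ w) = v @ (state_at d (aut_power d a m) v ^^ j) w"
proof (induction j)
  case (Suc j)
  let ?b = "state_at d (aut_power d a m) v"
  have b: "?b \<in> tree_auts d" using state_at(1)[OF aut_power_tree_auts[OF a] v] .
  have "(a ^^ (m * Suc j)) (v @ w) = (a ^^ m) (v @ (?b ^^ j) w)"
    using Suc by (simp add: funpow_add)
  then show ?case using funpow_append[OF a v funpow_words[OF b w], of m j] m by simp
qed simp

lemma funpow_fixed_of_repeat:
  assumes a: "a \<in> tree_auts d" and w: "w \<in> words d" and ij: "i < j" "(a ^^ i) w = (a ^^ j) w"
  shows "(a ^^ (j - i)) w = w"
proof -
  have "(a ^^ j) w = (a ^^ i) ((a ^^ (j - i)) w)"
    using ij(1) by (metis comp_apply funpow_add le_add_diff_inverse less_imp_le)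
  then have "aut_power d a i ((a ^^ (j - i)) w) = aut_power d a i w"
    using ij(2) w funpow_words[OF a w] by (simp add: aut_power_apply)
  then show ?thesis
    using inj_onD[OF tree_autsD(3)[OF aut_power_tree_auts[OF a]]] w funpow_words[OF a w] by blast
qed

text \<open>
  The section at \<open>v\<close> of a power that returns to \<open>v\<close> permutes the \<open>d\<close> letters below \<open>v\<close>, so each of them
  comes back after at most \<open>d\<close> steps.
\<close>
lemma returns_snoc:
  assumes a: "a \<in> tree_auts d" and vx: "v @ [x] \<in> words d" and m: "(a ^^ m) v = v"
  shows "\<exists>j. 0 < j \<and> j \<le> d \<and> (a ^^ (m * j)) (v @ [x]) = v @ [x]"
proof -
  have v: "v \<in> words d" and x: "[x] \<in> words d" using vx by auto
  define b where "b = state_at d (aut_power d a m) v"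
  have b: "b \<in> tree_auts d" unfolding b_def using state_at(1)[OF aut_power_tree_auts[OF a] v] .
  have "(b ^^ j) [x] \<in> (\<lambda>y. [y]) ` {1..d}" for j
    using funpow_words[OF b x, of j] funpow_length[OF b x, of j] by (auto simp: length_Suc_conv)
  then have "(\<lambda>j. (b ^^ j) [x]) ` {..d} \<subseteq> (\<lambda>y. [y]) ` {1..d}" by blast
  then have "card ((\<lambda>j. (b ^^ j) [x]) ` {..d}) \<le> d"
    by (metis (no_types, lifting) card_image_le card_mono finite_imageI finite_atLeastAtMost
        card_atLeastAtMost diff_Suc_1 order_trans)
  then have "\<not> inj_on (\<lambda>j. (b ^^ j) [x]) {..d}" by (intro pigeonhole) simp
  then obtain i j where ij: "i < j" "j \<le> d" "(b ^^ i) [x] = (b ^^ j) [x]"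
    unfolding inj_on_def by (metis atMost_iff linorder_neqE_nat)
  then have "(a ^^ (m * (j - i))) (v @ [x]) = v @ [x]"
    using funpow_fixed_of_repeat[OF b x] funpow_return[OF a v m x] by (simp add: b_def)
  with ij show ?thesis by (intro exI[of _ "j - i"]) auto
qed

lemma period_word:
  assumes a: "a \<in> tree_auts d" and v: "v \<in> words d"
  shows "period a v > 0" "(a ^^ period a v) v = v"
proof -
  have "\<exists>m>0. (a ^^ m) v = v"
    using v
  proof (induction v rule: rev_induct)
    case Nil
    then show ?case using tree_autsD(5)[OF a] by (intro exI[of _ 1]) simp
  next
    case (snoc x v)
    then obtain m where "m > 0" "(a ^^ m) v = v" by auto
    with returns_snoc[OF a snoc.prems, of m] show ?case by (metis nat_0_less_mult_iff)
  qed
  then obtain m where m: "m > 0" "(a ^^ m) v = v" by blast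
  show "period a v > 0" "(a ^^ period a v) v = v" by (rule period_LeastI[OF m])+
qed

lemma period_snoc_le:
  assumes a: "a \<in> tree_auts d" and vx: "v @ [x] \<in> words d"
  shows "period a (v @ [x]) \<le> period a v * d"
proof -
  have v: "v \<in> words d" using vx by simp
  obtain j where j: "0 < j" "j \<le> d" "(a ^^ (period a v * j)) (v @ [x]) = v @ [x]"
    using returns_snoc[OF a vx period_word(2)[OF a v]] by blast
  then have "period a (v @ [x]) \<le> period a v * j"
    using period_LeastI(3) period_word(1)[OF a v] by (metis nat_0_less_mult_iff)
  also have "\<dots> \<le> period a v * d" using j by simp
  finally show ?thesis .
qed

lemma period_prefix_dvd:
  assumes a: "a \<in> tree_auts d" and vu: "v @ u \<in> words d"
  shows "period a v dvd period a (v @ u)"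
proof (rule period_dvd)
  let ?m = "period a (v @ u)"
  have v: "v \<in> words d" "u \<in> words d" using vu by auto
  have "(a ^^ ?m) v @ state_at d (aut_power d a ?m) v u = v @ u"
    using period_word(2)[OF a vu] funpow_append[OF a v] by simp
  then show "(a ^^ ?m) v = v" using funpow_length[OF a v(1)] by simp
qed

lemma finite_order_if_periods_bounded:
  assumes a: "a \<in> tree_auts d" and bd: "\<And>w. w \<in> words d \<Longrightarrow> period a w \<le> N"
  shows "aut_power d a (fact N) = tree_id d"
  unfolding aut_power_eq_id_iff[OF a]
proof
  fix w assume w: "w \<in> words d"
  have "period a w dvd fact N"
    using period_word(1)[OF a w] bd[OF w] by (intro dvd_fact) auto
  then show "(a ^^ fact N) w = w"
    using funpow_mult_fixed[OF period_word(2)[OF a w]] by (auto elim: dvdE)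
qed

section \<open>Certificates of infinite order\<close>

text \<open>
  Write \<open>g\<close> for the section of \<open>a ^^ m\<close> at \<open>v\<close>. The conditions say that \<open>g\<close> moves \<open>u\<close>, that \<open>g ^^ l\<close> fixes \<open>u\<close>,
  and that the section of \<open>g ^^ l\<close> at \<open>u\<close> is \<open>g\<close> again. The numbers \<open>m\<close> and \<open>m * l\<close> may be any return
  times, not only the periods of \<open>v\<close> and \<open>v @ u\<close>; this spares the test from checking minimality.
\<close>
definition infinite_order_certificate ::
  "nat \<Rightarrow> (nat list \<Rightarrow> nat list) \<Rightarrow> nat \<Rightarrow> nat \<Rightarrow> nat list \<Rightarrow> nat list \<Rightarrow> bool" where
  "infinite_order_certificate d a m l v u \<longleftrightarrow> v \<in> words d \<and> u \<in> words d \<and>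
     (a ^^ m) v = v \<and> (a ^^ (m * l)) (v @ u) = v @ u \<and> (a ^^ m) (v @ u) \<noteq> v @ u \<and>
     state_at d (aut_power d a m) v = state_at d (aut_power d a (m * l)) (v @ u)"

text \<open>
  Let \<open>r\<close> be the order of \<open>g\<close>, assumed finite, and let \<open>p > 1\<close> be the period of \<open>u\<close> under \<open>g\<close>. It divides both
  \<open>r\<close> and \<open>l\<close>, so \<open>r\<close> divides \<open>l * (r div p)\<close>. Below \<open>u\<close>, the power \<open>g ^^ (l * j)\<close> acts as \<open>g ^^ j\<close>; hence
  \<open>g ^^ (r div p)\<close> is trivial, against the choice of \<open>r\<close>.
\<close>
lemma infinite_order_if_certificate:
  assumes a: "a \<in> tree_auts d" and cert: "infinite_order_certificate d a m l v u" and n: "n > 0"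
  shows "aut_power d a n \<noteq> tree_id d"
proof
  assume "aut_power d a n = tree_id d"
  then have an: "(a ^^ n) w = w" if "w \<in> words d" for w
    using aut_power_eq_id_iff[OF a] that by blast
  from cert have v: "v \<in> words d" and u: "u \<in> words d" and m: "(a ^^ m) v = v"
    and ml: "(a ^^ (m * l)) (v @ u) = v @ u" and moved: "(a ^^ m) (v @ u) \<noteq> v @ u"
    and same: "state_at d (aut_power d a m) v = state_at d (aut_power d a (m * l)) (v @ u)"
    by (auto simp: infinite_order_certificate_def)
  define g where "g = state_at d (aut_power d a m) v"
  have g: "g \<in> tree_auts d" unfolding g_def using state_at(1)[OF aut_power_tree_auts[OF a] v] .
  have ret: "(a ^^ (m * j)) (v @ w) = v @ (g ^^ j) w" if "w \<in> words d" for j w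
    unfolding g_def by (rule funpow_return[OF a v m that])
  have gn: "(g ^^ n) w = w" if w: "w \<in> words d" for w
    using ret[OF w, of n] funpow_mult_fixed[OF an, of "v @ w" m] v w by (simp add: mult.commute)
  have gl: "(g ^^ l) u = u" using ret[OF u, of l] ml by simp
  have gu: "g u \<noteq> u" using ret[OF u, of 1] moved by simp
  have sim: "(g ^^ l) (u @ w) = u @ g w" if w: "w \<in> words d" for w
    using ret[of "u @ w" l] funpow_append[OF a, of "v @ u" w "m * l"] u v w ml same
    by (simp add: g_def)
  have simj: "(g ^^ (l * j)) (u @ w) = u @ (g ^^ j) w" if w: "w \<in> words d" for j w
  proof (induction j)
    case (Suc j)
    then show ?case using sim[OF funpow_words[OF g w]] by (simp add: funpow_add)
  qed simp
  define r where "r = (LEAST r. r > 0 \<and> (\<forall>w\<in>words d. (g ^^ r) w = w))"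
  have r: "r > 0" "\<And>w. w \<in> words d \<Longrightarrow> (g ^^ r) w = w"
    using LeastI[of "\<lambda>r. r > 0 \<and> (\<forall>w\<in>words d. (g ^^ r) w = w)" n] n gn
    unfolding r_def[symmetric] by auto
  have r_le: "r \<le> k" if "k > 0" "\<forall>w\<in>words d. (g ^^ k) w = w" for k
    unfolding r_def using that by (intro Least_le) auto
  obtain i where i: "l = period g u * i" using period_dvd[OF gl] by (auto elim: dvdE)
  obtain k where k: "r = period g u * k" using period_dvd[OF r(2)[OF u]] by (auto elim: dvdE)
  have "(g ^^ k) w = w" if w: "w \<in> words d" for w
  proof -
    have "l * k = r * i" using i k by simp
    then have "(g ^^ (l * k)) (u @ w) = u @ w"
      using funpow_mult_fixed[OF r(2)[of "u @ w"], of i] u w by simp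
    then show ?thesis using simj[OF w, of k] by simp
  qed
  then have "r \<le> k" using r_le r(1) k by (cases "k = 0") auto
  then have "period g u = 1" using k r(1) by (cases "period g u") auto
  then show False using gu period_word(2)[OF g u] by simp
qed

section \<open>Bounded automorphisms have finitely many return sections\<close>

lemma finite_words_of_length: "finite {u \<in> words d. length u = k}"
proof -
  have "{u \<in> words d. length u = k} = {u. set u \<subseteq> {1..d} \<and> length u = k}"
    by (auto simp: words_def)
  then show ?thesis using finite_lists_length_eq[of "{1..d}" k] by simp
qed

lemma active_state_exists:
  assumes s: "s \<in> tree_auts d" and "s \<noteq> tree_id d"
  shows "\<exists>w\<in>words d. \<exists>x\<in>{1..d}. state_at d s w [x] \<noteq> [x]"
proof (rule ccontr)
  assume inactive: "\<not> ?thesis"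
  have "s w = w" if "w \<in> words d" for w
    using that
  proof (induction w rule: rev_induct)
    case Nil
    then show ?case using tree_autsD(5)[OF s] by simp
  next
    case (snoc x w)
    then show ?case using state_at(2)[OF s, of w "[x]"] inactive by auto
  qed
  then have "s = tree_id d" by (intro tree_aut_eqI[OF s tree_id_tree_auts]) auto
  with assms(2) show False by simp
qed

text \<open>
  Boundedness speaks of words where the section moves a letter, whereas here all words with a
  nontrivial section are counted. Every nontrivial state \<open>s\<close> has a word \<open>W s\<close> leading to a state that
  moves a letter, and appending \<open>W s\<close> sends the words with section \<open>s\<close> injectively to words that are
  counted by \<open>theta\<close> at a level that is deeper by a fixed amount. There are finitely many \<open>s\<close>.
\<close>
lemma bounded_nontrivial_states:
  assumes "bounded_aut d a"
  shows "\<exists>C. \<forall>k. card {u \<in> words d. length u = k \<and> state_at d a u \<noteq> tree_id d} \<le> C"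
proof -
  from assms obtain C where a: "a \<in> tree_auts d" and fin: "finite (states d a)"
    and C: "\<And>k. theta d a k \<le> C"
    by (auto simp: bounded_aut_def finite_state_def)
  let ?S = "states d a - {tree_id d}"
  have "\<exists>w. w \<in> words d \<and> (\<exists>x\<in>{1..d}. state_at d s w [x] \<noteq> [x])" if "s \<in> ?S" for s
    using that active_state_exists states_tree_auts[OF a] by blast
  then obtain W where W: "\<And>s. s \<in> ?S \<Longrightarrow> W s \<in> words d"
      "\<And>s. s \<in> ?S \<Longrightarrow> \<exists>x\<in>{1..d}. state_at d s (W s) [x] \<noteq> [x]"
    by metis
  have bd: "card {u \<in> words d. length u = k \<and> state_at d a u = s} \<le> C" if s: "s \<in> ?S" for s k
  proof -
    let ?A = "{u \<in> words d. length u = k \<and> state_at d a u = s}"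
    let ?B = "{v \<in> words d. length v = k + length (W s) \<and> (\<exists>x\<in>{1..d}. state_at d a v [x] \<noteq> [x])}"
    have "(\<lambda>u. u @ W s) ` ?A \<subseteq> ?B" using W[OF s] state_at_append[OF a] by auto
    moreover have "finite ?B"
      by (rule finite_subset[OF _ finite_words_of_length[of d "k + length (W s)"]]) auto
    moreover have "inj_on (\<lambda>u. u @ W s) ?A" by (auto intro: inj_onI)
    ultimately have "card ?A \<le> card ?B" by (meson card_inj_on_le)
    then show ?thesis using C[of "k + length (W s)"] by (simp add: theta_def)
  qed
  have "card {u \<in> words d. length u = k \<and> state_at d a u \<noteq> tree_id d} \<le> card ?S * C" for k
  proof -
    have "{u \<in> words d. length u = k \<and> state_at d a u \<noteq> tree_id d}
        = (\<Union>s\<in>?S. {u \<in> words d. length u = k \<and> state_at d a u = s})"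
      by (auto simp: states_def)
    also have "card \<dots> \<le> (\<Sum>s\<in>?S. card {u \<in> words d. length u = k \<and> state_at d a u = s})"
      using fin by (intro card_UN_le) auto
    also have "\<dots> \<le> card ?S * C" by (rule sum_bounded_above[of ?S _ C, simplified]) (use bd in blast)
    finally show ?thesis .
  qed
  then show ?thesis by blast
qed

fun products :: "nat \<Rightarrow> (nat list \<Rightarrow> nat list) set \<Rightarrow> nat \<Rightarrow> (nat list \<Rightarrow> nat list) set" where
  "products d S 0 = {tree_id d}"
| "products d S (Suc k) = (\<lambda>(s, f). compose (words d) s f) ` (S \<times> products d S k)"

lemma finite_products: "finite S \<Longrightarrow> finite (products d S k)"
  by (induction k) auto

text \<open>
  The section of \<open>a ^^ n\<close> at \<open>v\<close> is the product of the sections of \<open>a\<close> along the orbit of \<open>v\<close>, and the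
  trivial factors can be omitted.
\<close>
lemma state_at_aut_power_products:
  assumes a: "a \<in> tree_auts d" and v: "v \<in> words d"
  shows "state_at d (aut_power d a n) v
    \<in> products d (states d a) (card {i. i < n \<and> state_at d a ((a ^^ i) v) \<noteq> tree_id d})"
proof (induction n)
  case 0
  then show ?case using state_at_id[OF v] by (simp add: aut_power_0)
next
  case (Suc n)
  let ?s = "state_at d a ((a ^^ n) v)" and ?f = "state_at d (aut_power d a n) v"
  let ?I = "\<lambda>n. {i. i < n \<and> state_at d a ((a ^^ i) v) \<noteq> tree_id d}"
  have s: "?s \<in> states d a" using funpow_words[OF a v] by (simp add: states_def)
  have f: "?f \<in> tree_auts d" using state_at(1)[OF aut_power_tree_auts[OF a] v] .
  show ?case
  proof (cases "?s = tree_id d")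
    case True
    then have "?I (Suc n) = ?I n" by (auto simp: less_Suc_eq)
    moreover have "compose (words d) (tree_id d) ?f = ?f"
      using f tree_autsD(4)[OF f] tree_autsD(6)[OF f]
      by (auto simp: compose_def fun_eq_iff extensional_def)
    ultimately show ?thesis using Suc True by (simp add: state_at_aut_power_Suc[OF a v])
  next
    case False
    then have "?I (Suc n) = insert n (?I n)" by (auto simp: less_Suc_eq)
    then have "card (?I (Suc n)) = Suc (card (?I n))" by simp
    then show ?thesis using Suc s by (auto simp: state_at_aut_power_Suc[OF a v])
  qed
qed

text \<open>
  During one period the orbit of \<open>v\<close> visits distinct words of one length, so only boundedly many
  of the factors are nontrivial, however long the period is.
\<close>
lemma finite_return_sections:
  assumes "bounded_aut d a"
  shows "finite ((\<lambda>v. state_at d (aut_power d a (period a v)) v) ` words d)"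
proof -
  from assms have a: "a \<in> tree_auts d" and fin: "finite (states d a)"
    by (auto simp: bounded_aut_def finite_state_def)
  obtain C where
    C: "\<And>k. card {u \<in> words d. length u = k \<and> state_at d a u \<noteq> tree_id d} \<le> C"
    using bounded_nontrivial_states[OF assms] by blast
  have "state_at d (aut_power d a (period a v)) v \<in> (\<Union>k\<le>C. products d (states d a) k)"
    if v: "v \<in> words d" for v
  proof -
    let ?I = "{i. i < period a v \<and> state_at d a ((a ^^ i) v) \<noteq> tree_id d}"
    let ?U = "{u \<in> words d. length u = length v \<and> state_at d a u \<noteq> tree_id d}"
    have "inj_on (\<lambda>i. (a ^^ i) v) {..<period a v}"
    proof (rule linorder_inj_onI)
      fix i j assume ij: "i < j" "i \<in> {..<period a v}" "j \<in> {..<period a v}"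
      show "(a ^^ i) v \<noteq> (a ^^ j) v"
      proof
        assume "(a ^^ i) v = (a ^^ j) v"
        then have "(a ^^ (j - i)) v = v" using funpow_fixed_of_repeat[OF a v] ij by simp
        then show False using period_LeastI(3)[of "j - i" a v] ij by simp
      qed
    qed linarith
    then have "inj_on (\<lambda>i. (a ^^ i) v) ?I" by (rule inj_on_subset) auto
    moreover have "(\<lambda>i. (a ^^ i) v) ` ?I \<subseteq> ?U"
      using funpow_words[OF a v] funpow_length[OF a v] by auto
    moreover have "finite ?U"
      by (rule finite_subset[OF _ finite_words_of_length[of d "length v"]]) auto
    ultimately have "card ?I \<le> card ?U" by (meson card_inj_on_le)
    also have "\<dots> \<le> C" by (rule C)
    finally show ?thesis using state_at_aut_power_products[OF a v, of "period a v"] by blast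
  qed
  then have "(\<lambda>v. state_at d (aut_power d a (period a v)) v) ` words d
      \<subseteq> (\<Union>k\<le>C. products d (states d a) k)"
    by (rule image_subsetI)
  then show ?thesis by (rule finite_subset) (simp add: finite_products[OF fin])
qed

text \<open>
  Without a certificate, the period cannot change between two prefixes of a word that have the
  same return section. It therefore changes at most as often as a new return section appears, and by
  a factor of at most \<open>d\<close> each time. As there are finitely many return sections, all periods are bounded,
  and the automorphism has finite order.
\<close>
lemma certificate_exists:
  assumes bd: "bounded_aut d a" and inf: "\<And>n. n > 0 \<Longrightarrow> aut_power d a n \<noteq> tree_id d"
  shows "\<exists>m l v u. infinite_order_certificate d a m l v u"
proof (rule ccontr)
  assume none: "\<not> ?thesis"
  from bd have a: "a \<in> tree_auts d" by (auto simp: bounded_aut_def finite_state_def)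
  have d: "d > 0"
  proof (rule ccontr)
    assume "\<not> d > 0"
    then have "words d = {[]}" by (auto simp: words_def)
    then show False using inf[of 1] tree_autsD(5)[OF a] aut_power_eq_id_iff[OF a, of 1] by simp
  qed
  define ret where "ret v = state_at d (aut_power d a (period a v)) v" for v
  have same: "period a (v @ u) = period a v"
    if vu: "v @ u \<in> words d" and eq: "ret (v @ u) = ret v" for v u
  proof -
    have v: "v \<in> words d" "u \<in> words d" using vu by auto
    obtain l where l: "period a (v @ u) = period a v * l"
      using period_prefix_dvd[OF a vu] by (auto elim: dvdE)
    have "\<not> infinite_order_certificate d a (period a v) l v u" using none by blast
    then have "(a ^^ period a v) (v @ u) = v @ u"
      using v eq period_word(2)[OF a v(1)] period_word(2)[OF a vu] l
      by (auto simp: infinite_order_certificate_def ret_def)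
    then have "period a (v @ u) dvd period a v" by (rule period_dvd)
    then show ?thesis using period_prefix_dvd[OF a vu] by (rule dvd_antisym)
  qed
  let ?pre = "\<lambda>w. {v. \<exists>u. v @ u = w}"
  have pre_snoc: "?pre (w @ [x]) = insert (w @ [x]) (?pre w)" for w and x :: nat
    by (auto simp: append_eq_append_conv2 append_eq_Cons_conv)
  have fin_pre: "finite (?pre w)" for w :: "nat list"
    by (induction w rule: rev_induct) (simp_all only: pre_snoc finite_insert, simp)
  have bound: "period a w \<le> d ^ card (ret ` ?pre w)" if "w \<in> words d" for w
    using that
  proof (induction w rule: rev_induct)
    case Nil
    have "period a [] \<le> 1" by (rule period_LeastI(3)) (use tree_autsD(5)[OF a] in auto)
    also have "\<dots> \<le> d ^ card (ret ` ?pre [])" using d by simp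
    finally show ?case .
  next
    case (snoc x w)
    then have w: "w \<in> words d" and IH: "period a w \<le> d ^ card (ret ` ?pre w)" by auto
    show ?case
    proof (cases "ret (w @ [x]) \<in> ret ` ?pre w")
      case True
      then obtain v u where vu: "w = v @ u" "ret (w @ [x]) = ret v" by auto
      then have "period a (w @ [x]) = period a v" using same[of v "u @ [x]"] snoc.prems by simp
      also have "\<dots> \<le> period a w"
        using period_prefix_dvd[OF a, of v u] w vu period_word(1)[OF a w] by (auto intro: dvd_imp_le)
      also note IH
      also have "ret ` ?pre w = ret ` ?pre (w @ [x])"
        using True unfolding pre_snoc by (simp add: insert_absorb)
      finally show ?thesis .
    next
      case False
      then have "card (ret ` ?pre (w @ [x])) = Suc (card (ret ` ?pre w))"
        unfolding pre_snoc using fin_pre by simp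
      moreover have "period a (w @ [x]) \<le> d ^ card (ret ` ?pre w) * d"
        using period_snoc_le[OF a snoc.prems] mult_le_mono1[OF IH] by (rule order_trans)
      ultimately show ?thesis by (simp add: mult.commute)
    qed
  qed
  have "period a w \<le> d ^ card (ret ` words d)" if w: "w \<in> words d" for w
  proof -
    have "ret ` ?pre w \<subseteq> ret ` words d" using w by auto
    moreover have "finite (ret ` words d)" unfolding ret_def by (rule finite_return_sections[OF bd])
    ultimately have "card (ret ` ?pre w) \<le> card (ret ` words d)" by (rule card_mono[rotated])
    then have "d ^ card (ret ` ?pre w) \<le> d ^ card (ret ` words d)"
      using d by (intro power_increasing) auto
    then show ?thesis using bound[OF w] by linarith
  qed
  from finite_order_if_periods_bounded[OF a this]
  show False using inf[of "fact (d ^ card (ret ` words d))"] by simp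
qed

section \<open>Action of a coded automaton on coded words\<close>

text \<open>
  Words of length \<open>k\<close> are coded by the numbers below \<open>d ^ k\<close>, first letter in the lowest digit, so that
  quantification over a level is a bounded quantifier. The digit of a letter \<open>x\<close> is \<open>x - 1\<close>.
\<close>
fun word_num :: "nat \<Rightarrow> nat list \<Rightarrow> nat" where
  "word_num d [] = 0"
| "word_num d (x # w) = (x - 1) + d * word_num d w"

lemma word_num_append: "word_num d (v @ w) = word_num d v + d ^ length v * word_num d w"
  by (induction v) (simp_all add: algebra_simps)

lemma word_num_less: "w \<in> words d \<Longrightarrow> word_num d w < d ^ length w"
proof (induction w)
  case (Cons x w)
  then have x: "x - 1 < d" and IH: "Suc (word_num d w) \<le> d ^ length w" by auto
  have "word_num d (x # w) < d * Suc (word_num d w)" using x by simp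
  also have "\<dots> \<le> d ^ length (x # w)" using mult_le_mono2[OF IH, of d] by simp
  finally show ?case .
qed simp

lemma low_digit:
  fixes t d z :: nat
  assumes "t < d" shows "(t + d * z) mod d = t" "(t + d * z) div d = z"
  using assms by simp_all

lemma word_num_eq_iff:
  assumes "v \<in> words d" "w \<in> words d" "length v = length w"
  shows "word_num d v = word_num d w \<longleftrightarrow> v = w"
proof
  assume "word_num d v = word_num d w"
  with assms show "v = w"
  proof (induction v arbitrary: w)
    case (Cons x v)
    then obtain y w' where w: "w = y # w'" by (cases w) auto
    have xy: "1 \<le> x" "x - 1 < d" "1 \<le> y" "y - 1 < d" using Cons.prems w by auto
    have eq: "x - 1 + d * word_num d v = y - 1 + d * word_num d w'" using Cons.prems w by simp
    then have "x - 1 = y - 1" "word_num d v = word_num d w'"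
      using low_digit[OF xy(2)] low_digit[OF xy(4)] by metis+
    then show ?case using Cons.IH[of w'] Cons.prems w xy by simp
  qed simp
qed simp

lemma word_num_surj: "z < d ^ k \<Longrightarrow> \<exists>w\<in>words d. length w = k \<and> word_num d w = z"
proof (induction k arbitrary: z)
  case (Suc k)
  then have d: "d > 0" by (cases d) auto
  have "z div d < d ^ k" using Suc.prems by (simp add: less_mult_imp_div_less mult.commute)
  then obtain w where w: "w \<in> words d" "length w = k" "word_num d w = z div d"
    using Suc.IH by blast
  have "Suc (z mod d) # w \<in> words d" using w d by (simp add: Suc_le_eq)
  moreover have "word_num d (Suc (z mod d) # w) = z" using w by simp
  ultimately show ?case using w by (intro bexI[of _ "Suc (z mod d) # w"]) auto
qed (auto intro: bexI[of _ "[]"])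

definition table_entry :: "nat \<Rightarrow> nat \<Rightarrow> nat \<Rightarrow> nat" where
  "table_entry c i x = code_nth (code_nth (snd (prod_decode c)) i) x"

text \<open>
  The argument \<open>p\<close> codes a pair of a state and a word of length \<open>k\<close>. The lowest digit is read and
  removed, and the output is inserted as the highest digit. After \<open>k\<close> steps the word has rotated once,
  which leaves the image with its digits in the original order.
\<close>
definition run_step :: "nat \<Rightarrow> nat \<Rightarrow> nat \<Rightarrow> nat \<Rightarrow> nat" where
  "run_step d c k p = prod_encode
     (snd (prod_decode (table_entry c (fst (prod_decode p)) (snd (prod_decode p) mod d))),
      snd (prod_decode p) div d + d ^ (k - 1) *
        (fst (prod_decode (table_entry c (fst (prod_decode p)) (snd (prod_decode p) mod d))) - 1))"

definition run :: "nat \<Rightarrow> nat \<Rightarrow> nat \<Rightarrow> nat \<Rightarrow> nat" where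
  "run d c k z = snd (prod_decode ((run_step d c k ^^ k) (prod_encode (fst (prod_decode c), z))))"

lemma recursive_run [recursive_intros]:
  assumes "recursive n F" "recursive n G" "recursive n H"
  shows "recursive n (\<lambda>e. run d (F e) (G e) (H e))"
  by (rule recursive_compose3[OF _ assms])
    (unfold run_def run_step_def table_entry_def, intro recursive_intros; simp)

lemma table_entry_code:
  assumes "i < length tab" "x < length (tab ! i)"
  shows "prod_decode (table_entry (automaton_code (i0, tab)) i x) = tab ! i ! x"
  using assms by (simp add: table_entry_def automaton_code_def code_nth_list_encode)

lemma run_automaton:
  assumes a: "a \<in> tree_auts d" and M: "automaton_of d a M" and w: "w \<in> words d"
  shows "run d (automaton_code M) (length w) (word_num d w) = word_num d (a w)"
proof -
  obtain i0 tab where Mt: "M = (i0, tab)" by (cases M)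
  define c where "c = automaton_code M"
  obtain q where *: "bij_betw q {..<length tab} (states d a) \<and> i0 < length tab \<and> q i0 = a \<and>
       (\<forall>i<length tab. length (tab ! i) = d \<and>
         (\<forall>x\<in>{1..d}. case tab ! i ! (x - 1) of (y, j) \<Rightarrow>
            [y] = q i [x] \<and> j < length tab \<and> q j = state_at d (q i) [x]))"
    using M unfolding automaton_of_def Mt prod.case by (elim exE) (rule that)
  then have q: "bij_betw q {..<length tab} (states d a)" and i0: "i0 < length tab" "q i0 = a"
    by simp_all
  have row: "length (tab ! i) = d" if "i < length tab" for i
    using * that by simp
  have entry: "case tab ! i ! (x - 1) of (y, j) \<Rightarrow>
      [y] = q i [x] \<and> j < length tab \<and> q j = state_at d (q i) [x]"
    if "i < length tab" "x \<in> {1..d}" for i x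
    using *[THEN conjunct2, THEN conjunct2, THEN conjunct2, THEN spec, THEN mp, OF that(1),
        THEN conjunct2, THEN bspec, OF that(2)] .
  have qi: "q i \<in> tree_auts d" if "i < length tab" for i
    using that q states_tree_auts[OF a] by (auto simp: bij_betw_def)
  \<comment> \<open>In the middle of the rotation, \<open>w\<close> is still to be read and \<open>v\<close> has been written.\<close>
  have steps: "\<exists>j. (run_step d c k ^^ length w) (prod_encode (i, word_num d (w @ v)))
      = prod_encode (j, word_num d (v @ q i w))"
    if "w \<in> words d" "i < length tab" "k = length w + length v" for w v i k
    using that
  proof (induction w arbitrary: i v)
    case Nil
    then show ?case using tree_autsD(5)[OF qi] by auto
  next
    case (Cons x w)
    then have x: "x \<in> {1..d}" "x - 1 < d" and w: "w \<in> words d" by auto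
    obtain y j where yj: "tab ! i ! (x - 1) = (y, j)" by fastforce
    have y: "q i [x] = [y]" and j: "j < length tab" "q j = state_at d (q i) [x]"
      using entry[OF Cons.prems(2) x(1)] yj by auto
    have e: "prod_decode (table_entry c i (x - 1)) = (y, j)"
      using table_entry_code[of i tab "x - 1" i0] Cons.prems(2) row x(2) yj by (simp add: c_def Mt)
    have k: "k - 1 = length (w @ v)" using Cons.prems(3) by simp
    have md: "(x - 1 + d * z) mod d = x - 1" "(x - 1 + d * z) div d = z" for z
      using low_digit[OF x(2)] by auto
    have "run_step d c k (prod_encode (i, word_num d ((x # w) @ v)))
        = prod_encode (j, word_num d (w @ v @ [y]))"
      using e md[of "word_num d (w @ v)"] word_num_append[of d "w @ v" "[y]"] k
      by (simp add: run_step_def)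
    moreover obtain j' where "(run_step d c k ^^ length w) (prod_encode (j, word_num d (w @ v @ [y])))
        = prod_encode (j', word_num d ((v @ [y]) @ q j w))"
      using Cons.IH[OF w j(1), of "v @ [y]"] Cons.prems(3) by auto
    moreover have "q i (x # w) = y # q j w"
      using state_at(2)[OF qi[OF Cons.prems(2)], of "[x]" w] w x y j by simp
    ultimately show ?case by (auto simp: funpow_Suc_right simp del: funpow.simps)
  qed
  obtain j where "(run_step d c (length w) ^^ length w) (prod_encode (i0, word_num d w))
      = prod_encode (j, word_num d (a w))"
    using steps[OF w i0(1), of "length w" "[]"] i0(2) by auto
  then show ?thesis by (simp add: run_def c_def[symmetric]) (simp add: c_def Mt automaton_code_def)
qed

lemma run_funpow_automaton:
  assumes a: "a \<in> tree_auts d" and M: "automaton_of d a M" and w: "w \<in> words d"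
  shows "(run d (automaton_code M) (length w) ^^ n) (word_num d w) = word_num d ((a ^^ n) w)"
proof (induction n)
  case (Suc n)
  then show ?case
    using run_automaton[OF a M funpow_words[OF a w], of n] funpow_length[OF a w, of n] by simp
qed simp

text \<open>
  The code itself serves as a bound for the number of states wherever only an upper bound matters.
\<close>
lemma card_states_le_code:
  assumes "automaton_of d a M" shows "card (states d a) \<le> automaton_code M"
proof -
  obtain i0 tab where M: "M = (i0, tab)" by (cases M)
  obtain q where "bij_betw q {..<length tab} (states d a)"
    using assms unfolding automaton_of_def M prod.case by (elim exE conjE) (rule that)
  then have "card (states d a) = length tab" using bij_betw_same_card by fastforce
  also have "\<dots> \<le> list_encode (map (\<lambda>row. list_encode (map prod_encode row)) tab)"
    using length_le_list_encode[of "map (\<lambda>row. list_encode (map prod_encode row)) tab"] by simp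
  also have "\<dots> \<le> automaton_code M" by (simp add: M automaton_code_def le_prod_encode_2)
  finally show ?thesis .
qed

section \<open>The search for the order\<close>

text \<open>
  The power \<open>a ^^ n\<close> has at most as many states as there are \<open>n\<close>-tuples of states of \<open>a\<close>, hence at most
  \<open>c ^ n\<close>, so that its action on level \<open>c ^ n\<close> decides whether it is trivial.
\<close>
definition torsion_test :: "nat \<Rightarrow> nat \<Rightarrow> nat \<Rightarrow> bool" where
  "torsion_test d c n \<longleftrightarrow> 0 < n \<and> (\<forall>z<d ^ (c ^ n). (run d c (c ^ n) ^^ n) z = z)"

text \<open>
  Here \<open>y\<close> and \<open>z\<close> code words \<open>v\<close> and \<open>u\<close> of lengths \<open>p\<close> and \<open>r\<close>. The division by \<open>d ^ p\<close> deletes the prefix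
  \<open>v\<close> from an image, which leaves the image under the section at \<open>v\<close>. The two sections in question
  have together at most \<open>c ^ m * c ^ (m * l)\<close> pairs of states, which explains the level.
\<close>
definition certificate_test ::
  "nat \<Rightarrow> nat \<Rightarrow> nat \<Rightarrow> nat \<Rightarrow> nat \<Rightarrow> nat \<Rightarrow> nat \<Rightarrow> nat \<Rightarrow> bool" where
  "certificate_test d c m l p r y z \<longleftrightarrow> y < d ^ p \<and> z < d ^ r \<and>
     (run d c p ^^ m) y = y \<and>
     (run d c (p + r) ^^ (m * l)) (y + d ^ p * z) = y + d ^ p * z \<and>
     \<not> (run d c (p + r) ^^ m) (y + d ^ p * z) = y + d ^ p * z \<and>
     (\<forall>x<d ^ (c ^ (m + m * l)).
        (run d c (p + c ^ (m + m * l)) ^^ m) (y + d ^ p * x) div d ^ p =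
        (run d c (p + r + c ^ (m + m * l)) ^^ (m * l)) (y + d ^ p * z + d ^ (p + r) * x)
          div d ^ (p + r))"

definition infinite_order_test :: "nat \<Rightarrow> nat \<Rightarrow> nat \<Rightarrow> bool" where
  "infinite_order_test d c n \<longleftrightarrow> (\<exists>m<n. \<exists>l<n. \<exists>p<n. \<exists>r<n. \<exists>y<n. \<exists>z<n.
     certificate_test d c m l p r y z)"

lemma decidable_torsion_test: "decidable 2 (\<lambda>e. torsion_test d (e 1) (e 0))"
  unfolding torsion_test_def by (intro recursive_intros; simp)

lemma decidable_infinite_order_test: "decidable 2 (\<lambda>e. infinite_order_test d (e 1) (e 0))"
  unfolding infinite_order_test_def certificate_test_def by (intro recursive_intros; simp)

lemma torsion_test_iff:
  assumes d: "d \<ge> 1" and fs: "finite_state d a" and M: "automaton_of d a M"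
  shows "torsion_test d (automaton_code M) n \<longleftrightarrow> 0 < n \<and> aut_power d a n = tree_id d"
proof -
  let ?c = "automaton_code M"
  have a: "a \<in> tree_auts d" using fs by (simp add: finite_state_def)
  have run: "(run d ?c (?c ^ n) ^^ n) (word_num d w) = word_num d w \<longleftrightarrow> (a ^^ n) w = w"
    if "w \<in> words d" "length w = ?c ^ n" for w
    using run_funpow_automaton[OF a M that(1), of n] that
      word_num_eq_iff[OF funpow_words[OF a that(1)] that(1) funpow_length[OF a that(1)]] by simp
  have "aut_power d a n = tree_id d \<longleftrightarrow> (\<forall>w\<in>words d. length w = ?c ^ n \<longrightarrow> (a ^^ n) w = w)"
  proof
    assume fixed: "\<forall>w\<in>words d. length w = ?c ^ n \<longrightarrow> (a ^^ n) w = w"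
    have "card (states d (aut_power d a n)) * card (states d (tree_id d)) \<le> card (states d a) ^ n"
      using states_aut_power[OF fs, of n] by (simp add: states_tree_id)
    also have "\<dots> \<le> ?c ^ n" by (intro power_mono card_states_le_code[OF M]) simp
    finally show "aut_power d a n = tree_id d"
      using fixed states_aut_power[OF fs, of n]
      by (intro tree_aut_eq_if_eq_on_level[OF d aut_power_tree_auts[OF a] tree_id_tree_auts])
        (auto simp: states_tree_id aut_power_apply)
  qed (simp add: aut_power_eq_id_iff[OF a])
  also have "\<dots> \<longleftrightarrow> (\<forall>z<d ^ (?c ^ n). (run d ?c (?c ^ n) ^^ n) z = z)"
    using run word_num_surj[of _ d "?c ^ n"] word_num_less by metis
  finally show ?thesis by (simp add: torsion_test_def)
qed

lemma certificate_test_iff: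
  assumes d: "d \<ge> 1" and fs: "finite_state d a" and M: "automaton_of d a M"
    and v: "v \<in> words d" and u: "u \<in> words d"
  shows "certificate_test d (automaton_code M) m l (length v) (length u) (word_num d v) (word_num d u)
    \<longleftrightarrow> infinite_order_certificate d a m l v u"
proof -
  let ?c = "automaton_code M"
  define K where "K = ?c ^ (m + m * l)"
  have a: "a \<in> tree_auts d" using fs by (simp add: finite_state_def)
  have vu: "v @ u \<in> words d" using v u by simp
  have num_vu: "word_num d v + d ^ length v * word_num d u = word_num d (v @ u)"
    by (simp add: word_num_append)
  have run: "(run d ?c k ^^ n) (word_num d w) = word_num d w \<longleftrightarrow> (a ^^ n) w = w"
    if "w \<in> words d" "k = length w" for w n k
    using run_funpow_automaton[OF a M that(1), of n] that
      word_num_eq_iff[OF funpow_words[OF a that(1)] that(1) funpow_length[OF a that(1)]] by simp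
  define f where "f = state_at d (aut_power d a m) v"
  define h where "h = state_at d (aut_power d a (m * l)) (v @ u)"
  have f: "f \<in> tree_auts d" and h: "h \<in> tree_auts d"
    unfolding f_def h_def using state_at(1) aut_power_tree_auts[OF a] v vu by blast+
  have sec: "(run d ?c (length s + K) ^^ n) (word_num d s + d ^ length s * word_num d w)
      div d ^ length s = word_num d (state_at d (aut_power d a n) s w)"
    if s: "s \<in> words d" and ret: "(a ^^ n) s = s" and w: "w \<in> words d" "length w = K" for s n w
  proof -
    have "(run d ?c (length s + K) ^^ n) (word_num d s + d ^ length s * word_num d w)
        = word_num d ((a ^^ n) (s @ w))"
      using run_funpow_automaton[OF a M, of "s @ w" n] s w by (simp add: word_num_append)
    also have "\<dots> = word_num d s
        + d ^ length s * word_num d (state_at d (aut_power d a n) s w)"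
      using funpow_append[OF a s w(1)] ret by (simp add: word_num_append)
    finally show ?thesis using low_digit(2)[OF word_num_less[OF s]] by simp
  qed
  have sections: "f = h \<longleftrightarrow> (\<forall>w\<in>words d. length w = K \<longrightarrow> f w = h w)"
  proof
    assume eq: "\<forall>w\<in>words d. length w = K \<longrightarrow> f w = h w"
    note sm = states_aut_power[OF fs, of m] and sml = states_aut_power[OF fs, of "m * l"]
    have sub: "states d f \<subseteq> states d (aut_power d a m)"
      "states d h \<subseteq> states d (aut_power d a (m * l))"
      unfolding f_def h_def by (intro states_state_at aut_power_tree_auts a v vu)+
    have fin: "finite (states d f)" "finite (states d h)"
      using sub sm sml finite_subset by blast+
    have "card (states d f) \<le> card (states d a) ^ m"
      using card_mono[OF conjunct1[OF sm] sub(1)] sm by linarith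
    moreover have "card (states d h) \<le> card (states d a) ^ (m * l)"
      using card_mono[OF conjunct1[OF sml] sub(2)] sml by linarith
    ultimately have "card (states d f) * card (states d h) \<le> card (states d a) ^ (m + m * l)"
      unfolding power_add by (rule mult_le_mono)
    also have "\<dots> \<le> K" unfolding K_def by (intro power_mono card_states_le_code[OF M]) simp
    finally show "f = h"
      using eq by (intro tree_aut_eq_if_eq_on_level[OF d f h fin]) auto
  qed simp
  show ?thesis
  proof (cases "(a ^^ m) v = v \<and> (a ^^ (m * l)) (v @ u) = v @ u")
    case False
    then show ?thesis
      using run[OF v refl, of m] run[OF vu, of "length v + length u" "m * l"]
      by (auto simp: certificate_test_def infinite_order_certificate_def num_vu)
  next
    case True
    let ?lhs = "\<lambda>x. (run d ?c (length v + K) ^^ m) (word_num d v + d ^ length v * x) div d ^ length v"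
    let ?rhs = "\<lambda>x. (run d ?c (length v + length u + K) ^^ (m * l))
      (word_num d (v @ u) + d ^ (length v + length u) * x) div d ^ (length v + length u)"
    have "?lhs (word_num d w) = ?rhs (word_num d w) \<longleftrightarrow> f w = h w"
      if w: "w \<in> words d" "length w = K" for w
    proof -
      have "?lhs (word_num d w) = word_num d (f w)"
        using sec[OF v _ w, of m] True by (simp add: f_def)
      moreover have "?rhs (word_num d w) = word_num d (h w)"
        using sec[OF vu _ w, of "m * l"] True by (simp add: h_def)
      moreover have "word_num d (f w) = word_num d (h w) \<longleftrightarrow> f w = h w"
        using w by (intro word_num_eq_iff) (auto simp: tree_autsD[OF f] tree_autsD[OF h]
            tree_aut_length[OF f] tree_aut_length[OF h])
      ultimately show ?thesis by simp
    qed
    then have "(\<forall>x<d ^ K. ?lhs x = ?rhs x) \<longleftrightarrow> f = h"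
      unfolding sections using word_num_surj[of _ d K] word_num_less by metis
    then show ?thesis
      using True run[OF v refl, of m] run[OF vu, of "length v + length u"]
        word_num_less[OF v] word_num_less[OF u] v u
      by (simp add: certificate_test_def infinite_order_certificate_def num_vu K_def f_def h_def)
  qed
qed

lemma infinite_order_test_iff:
  assumes "d \<ge> 1" "finite_state d a" "automaton_of d a M"
  shows "(\<exists>n. infinite_order_test d (automaton_code M) n)
    \<longleftrightarrow> (\<exists>m l v u. infinite_order_certificate d a m l v u)"
proof
  assume "\<exists>n. infinite_order_test d (automaton_code M) n"
  then obtain m l p r y z where *: "certificate_test d (automaton_code M) m l p r y z"
    unfolding infinite_order_test_def by blast
  then have "y < d ^ p" "z < d ^ r" by (auto simp: certificate_test_def)
  then obtain v u where "v \<in> words d" "length v = p" "word_num d v = y"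
    "u \<in> words d" "length u = r" "word_num d u = z"
    using word_num_surj by meson
  with * show "\<exists>m l v u. infinite_order_certificate d a m l v u"
    using certificate_test_iff[OF assms] by metis
next
  assume "\<exists>m l v u. infinite_order_certificate d a m l v u"
  then obtain m l v u where *: "infinite_order_certificate d a m l v u" by blast
  let ?n = "Suc (m + l + length v + length u + word_num d v + word_num d u)"
  have "v \<in> words d" "u \<in> words d" using * by (auto simp: infinite_order_certificate_def)
  then have "certificate_test d (automaton_code M) m l (length v) (length u)
      (word_num d v) (word_num d u)"
    using * certificate_test_iff[OF assms] by blast
  moreover have "m < ?n" "l < ?n" "length v < ?n" "length u < ?n" "word_num d v < ?n"
    "word_num d u < ?n" by auto
  ultimately have "infinite_order_test d (automaton_code M) ?n"
    unfolding infinite_order_test_def by blast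
  then show "\<exists>n. infinite_order_test d (automaton_code M) n" by blast
qed

text \<open>
  The search may diverge on arguments \<open>c\<close> without a solution.
\<close>
lemma search_then_output:
  assumes T: "decidable 2 (\<lambda>e. T (e 0) (e 1))" and G: "recursive 2 (\<lambda>e. G (e 0) (e 1))"
  shows "\<exists>f. \<forall>c. (\<exists>k. T k c) \<longrightarrow> rec_eval f [c] (G (LEAST k. T k c) c)"
proof -
  obtain t where "\<forall>xs. length xs = 2 \<longrightarrow> rec_eval t xs (of_bool (\<not> T (xs ! 0) (xs ! 1)))"
    using decidable_not[OF T] unfolding decidable_def recursive_def by blast
  then have t: "rec_eval t [k, c] (of_bool (\<not> T k c))" for k c
    by (metis One_nat_def length_Cons list.size(3) nth_Cons_0 nth_Cons_Suc numeral_2_eq_2)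
  obtain g where "\<forall>xs. length xs = 2 \<longrightarrow> rec_eval g xs (G (xs ! 0) (xs ! 1))"
    using G unfolding recursive_def by blast
  then have g: "rec_eval g [k, c] (G k c)" for k c
    by (metis One_nat_def length_Cons list.size(3) nth_Cons_0 nth_Cons_Suc numeral_2_eq_2)
  have "rec_eval (Comp g [Mu t, Proj 0]) [c] (G (LEAST k. T k c) c)" if ex: "\<exists>k. T k c" for c
  proof (rule rec_eval.comp[of "[LEAST k. T k c, c]"])
    have "rec_eval (Mu t) [c] (LEAST k. T k c)" by (rule rec_eval_Mu_Least[OF t ex])
    moreover have "rec_eval (Proj 0) [c] c" using rec_eval.proj[of 0 "[c]"] by simp
    ultimately show "\<forall>i<length [Mu t, Proj 0].
        rec_eval ([Mu t, Proj 0] ! i) [c] ([LEAST k. T k c, c] ! i)"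
      by (simp add: less_Suc_eq)
  qed (simp_all add: g)
  then show ?thesis by blast
qed

theorem proposition1:
  fixes d :: nat
  assumes "d \<ge> 1"
  shows "\<exists>f. \<forall>a M. bounded_aut d a \<longrightarrow> automaton_of d a M \<longrightarrow>
           rec_eval f [automaton_code M] (group.ord (Aut_T d) a)"
proof -
  let ?T = "\<lambda>n c. torsion_test d c n \<or> infinite_order_test d c n"
  let ?G = "\<lambda>n c. if torsion_test d c n then n else 0"
  have "\<exists>f. \<forall>c. (\<exists>k. ?T k c) \<longrightarrow> rec_eval f [c] (?G (LEAST k. ?T k c) c)"
    by (rule search_then_output)
      (intro recursive_intros decidable_torsion_test decidable_infinite_order_test; simp)+
  then obtain f where
    f: "\<And>c. \<exists>k. ?T k c \<Longrightarrow> rec_eval f [c] (?G (LEAST k. ?T k c) c)" by blast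
  have "rec_eval f [automaton_code M] (group.ord (Aut_T d) a)"
    if bd: "bounded_aut d a" and M: "automaton_of d a M" for a M
  proof -
    let ?c = "automaton_code M" and ?o = "group.ord (Aut_T d) a"
    have fs: "finite_state d a" and a: "a \<in> tree_auts d"
      using bd by (auto simp: bounded_aut_def finite_state_def)
    have torsion: "torsion_test d ?c n \<longleftrightarrow> 0 < n \<and> ?o dvd n" for n
      using torsion_test_iff[OF assms fs M] ord_dvd_iff_aut_power[OF a] by simp
    have power: "aut_power d a n = tree_id d \<longleftrightarrow> ?o dvd n" for n
      using ord_dvd_iff_aut_power[OF a] by simp
    have cert: "(\<exists>n. infinite_order_test d ?c n) \<longleftrightarrow> ?o = 0"
    proof
      assume "\<exists>n. infinite_order_test d ?c n"
      then obtain m l v u where "infinite_order_certificate d a m l v u"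
        using infinite_order_test_iff[OF assms fs M] by blast
      from infinite_order_if_certificate[OF a this, of ?o] show "?o = 0" using power by auto
    next
      assume "?o = 0"
      then have "aut_power d a n \<noteq> tree_id d" if "n > 0" for n using that power by simp
      from certificate_exists[OF bd this] show "\<exists>n. infinite_order_test d ?c n"
        using infinite_order_test_iff[OF assms fs M] by blast
    qed
    have ex: "\<exists>k. ?T k ?c"
    proof (cases "?o = 0")
      case False
      then have "torsion_test d ?c ?o" using torsion by simp
      then show ?thesis by blast
    qed (use cert in blast)
    have "?G (LEAST k. ?T k ?c) ?c = ?o"
    proof (cases "?o = 0")
      case True
      then show ?thesis using torsion by simp
    next
      case False
      then have "\<not> infinite_order_test d ?c k" for k using cert by simp
      then have T: "?T k ?c \<longleftrightarrow> 0 < k \<and> ?o dvd k" for k using torsion[of k] by simp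
      have "(LEAST k. ?T k ?c) = ?o"
        unfolding T using False by (intro Least_equality) (auto intro: dvd_imp_le)
      then show ?thesis using False torsion by simp
    qed
    then show ?thesis using f[OF ex] by simp
  qed
  then show ?thesis by blast
qed

end
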